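(* Suppose the capacity conditions $$\gamma_1^2I-P(t)B_1R_1^{-2}B_1^\top P(t)\succeq0,\qquad \gamma_2^2I-P(t)B_2(R_2+\lambda_2(t)I)^{-2}B_2^\top P(t)\succeq0\qquad(t\in[t_0,T])$$ hold. Let $(\alpha^d,\beta^d)\in\mathcal A_m^\pi\times\mathcal B_m^\pi$ be the synthesized Gaussian sample-and-hold mixed strategies: at each sampling time $t_k$, given $x(t_k)=x$, Player 1 draws $u_k\sim\mathcal N(\Gamma_{1,k}^*,\Sigma_{1,k}^* )$ and Player 2 draws $v_k\sim\mathcal N(\Gamma_{2,k}^*,\Sigma_{2,k}^* )$, independently, where $$\Gamma_{1,k}^*=-R_1^{-1}B_1^\top P(t_k)x,\quad \Sigma_{1,k}^*=\mathbf 0,\quad \Gamma_{2,k}^*=K_2(t_k)x,$$ $$\Sigma_{2,k}^*=x^\top\big(\gamma_2^2I-K_2(t_k)^\top K_2(t_k)\big)x\;v_2(t_k)v_2(t_k)^\top\,\mathbb I_{\{\lambda_{\max}(Q_{2,eq}(t_k))>0\}} .$$ Then $$J(t_0,x_0,\alpha^d,\beta^d)-\min_{\alpha\in\mathcal A_m^\pi}J(t_0,x_0,\alpha,\beta^d)\le\mathcal O(\bar\pi^{1/2}),$$ $$\max_{\beta\in\mathcal B_m^\pi}J(t_0,x_0,\alpha^d,\beta)-J(t_0,x_0,\alpha^d,\beta^d)\le\mathcal O(\bar\pi^{1/2}).$$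
   Context: **Game $\mathbf G_{lq}$.** Fix $t_0<T$, $x_0\in\mathbb R^d$, $A\in\mathbb R^{d\times d}$, $B_i\in\mathbb R^{d\times d_i}$ ($i=1,2$), symmetric positive definite $Q,Q_T\in\mathbb R^{d\times d}$, $R_i\in\mathbb R^{d_i\times d_i}$, with $(A,B_1)$ stabilizable and $(A,Q^{1/2})$ detectable; fix $\gamma_1,\gamma_2>0$. Dynamics: $\dot x=Ax+B_1u+B_2v$, $x(t_0)=x_0$. Cost: $J=\mathbb E\big[\int_{t_0}^T(x^\top Qx+u^\top R_1u-v^\top R_2v)dt+x(T)^\top Q_Tx(T)\big]$, minimized by Player 1 (control $u\in U=\mathbb R^{d_1}$), maximized by Player 2 (control $v\in V=\mathbb R^{d_2}$). **Partition.** $\pi=\{t_0<t_1<\dots<t_N=T\}$, $\bar\pi=\max_k(t_{k+1}-t_k)$, $\delta_\pi(t)=t_{k+1}-t_k$ on $[t_k,t_{k+1})$. **Mixed strategies.** $\alpha=\{\mu_k\}_{k=0}^{N-1}\in\mathcal A_m^\pi$: measurable maps $x\mapsto\mu_k(\cdot\mid x)$ into the probability measures on $U$ with $\int\|u\|^2\mu_k(du\mid x)\le\gamma_1^2\|x\|^2$. $\beta=\{\nu_k\}\in\mathcal B_m^\pi$: likewise on $V$ with $\gamma_2$. At $t_k$, given $x(t_k)$, $u_k\sim\mu_k(\cdot\mid x(t_k))$ and $v_k\sim\nu_k(\cdot\mid x(t_k))$ are sampled independently and held constant on $[t_k,t_{k+1})$. $J(t_0,x_0,\alpha,\beta)$ is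 the resulting expected cost. **Riccati equation.** $P$ is the (unique) symmetric solution on $[t_0,T]$ of $$-\dot P=A^\top P+PA+Q-PB_1R_1^{-1}B_1^\top P+PB_2(R_2+\lambda_2I)^{-1}B_2^\top P+\lambda_2\gamma_2^2I,\quad P(T)=Q_T,$$ where $Q_{2,eq}(t)=\delta_\pi(t)B_2^\top P(t)B_2-R_2$, $\lambda_2(t)=\max(0,\lambda_{\max}(Q_{2,eq}(t)))$. Further $K_2(t)=(R_2+\lambda_2(t)I)^{-1}B_2^\top P(t)$, and $v_2(t)$ is a unit eigenvector of $Q_{2,eq}(t)$ for its largest eigenvalue. ($P,\lambda_2,K_2,v_2$ depend on $\pi$.) $\mathcal N(m,S)$ is the Gaussian law with mean $m$ and (possibly singular) covariance $S$. **Convention.** $\mathcal O(\cdot)$ is as $\bar\pi\to0$ over partitions $\pi$ of $[t_0,T]$ for which the hypotheses hold; the implied constant may depend on the game data and $x_0$ but not on $\pi$. *)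

theory Defs
  imports "HOL-Probability.Probability"
begin

definition psd :: "real^'n^'n \<Rightarrow> bool" where
  "psd M \<longleftrightarrow> transpose M = M \<and> (\<forall>x. 0 \<le> x \<bullet> (M *v x))"

definition pos_def :: "real^'n^'n \<Rightarrow> bool" where
  "pos_def M \<longleftrightarrow> transpose M = M \<and> (\<forall>x. x \<noteq> 0 \<longrightarrow> 0 < x \<bullet> (M *v x))"

definition mat_sqrt :: "real^'n^'n \<Rightarrow> real^'n^'n" where
  "mat_sqrt M = (THE S. psd S \<and> S ** S = M)"

text \<open>Only used for symmetric matrices, whose set of real eigenvalues is finite and nonempty.\<close>

definition lambda_max :: "real^'n^'n \<Rightarrow> real" where
  "lambda_max M = Max {l. \<exists>x. x \<noteq> 0 \<and> M *v x = l *\<^sub>R x}"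

definition outer :: "real^'n \<Rightarrow> real^'n^'n" where
  "outer v = (\<chi> i j. v $ i * v $ j)"

definition hurwitz :: "real^'n^'n \<Rightarrow> bool" where
  "hurwitz M \<longleftrightarrow>
     (\<forall>l::complex. \<forall>z::complex^'n. z \<noteq> 0 \<and> map_matrix complex_of_real M *v z = l *s z \<longrightarrow> Re l < 0)"

definition stabilizable :: "real^'n^'n \<Rightarrow> real^'m^'n \<Rightarrow> bool" where
  "stabilizable A B \<longleftrightarrow> (\<exists>F. hurwitz (A + B ** F))"

definition detectable :: "real^'n^'n \<Rightarrow> real^'n^'m \<Rightarrow> bool" where
  "detectable A C \<longleftrightarrow> (\<exists>L. hurwitz (A + L ** C))"

text \<open>Defining the Gaussian law through the positive semidefinite square root of the covariance
  allows singular covariances.\<close>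

definition std_gaussian :: "(real^'n) measure" where
  "std_gaussian = distr (PiM UNIV (\<lambda>_. density lborel (\<lambda>x. ennreal (std_normal_density x)))) borel
     (\<lambda>z. \<chi> i. z i)"

definition gaussian :: "real^'n \<Rightarrow> real^'n^'n \<Rightarrow> (real^'n) measure" where
  "gaussian m S = distr std_gaussian borel (\<lambda>z. m + mat_sqrt S *v z)"

text \<open>A partition is the strictly increasing list of its points; it has
  \<^term>\<open>length \<pi> - 1\<close> intervals.\<close>

definition partition_of :: "real \<Rightarrow> real \<Rightarrow> real list \<Rightarrow> bool" where
  "partition_of a b \<pi> \<longleftrightarrow> \<pi> \<noteq> [] \<and> sorted_wrt (<) \<pi> \<and> hd \<pi> = a \<and> last \<pi> = b"

definition mesh :: "real list \<Rightarrow> real" where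
  "mesh \<pi> = Max {\<pi> ! Suc k - \<pi> ! k | k. Suc k < length \<pi>}"

text \<open>The interval containing \<open>t\<close>; the final time is assigned to the last interval, which
  extends \<open>\<delta>\<close> (undefined there in the half-open convention) by its left limit.\<close>

definition interval_index :: "real list \<Rightarrow> real \<Rightarrow> nat" where
  "interval_index \<pi> t = Max {k. Suc k < length \<pi> \<and> \<pi> ! k \<le> t}"

definition step_size :: "real list \<Rightarrow> real \<Rightarrow> real" where
  "step_size \<pi> t = \<pi> ! Suc (interval_index \<pi> t) - \<pi> ! interval_index \<pi> t"

text \<open>The dimensions \<open>d\<close>, \<open>d\<^sub>1\<close>, \<open>d\<^sub>2\<close> are the cardinalities of the index types
  \<open>'n\<close>, \<open>'p\<close>, \<open>'q\<close>.\<close>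

record ('n::finite, 'p::finite, 'q::finite) lq_game =
  t_init :: real
  t_final :: real
  x_init :: "real^'n"
  mat_A :: "real^'n^'n"
  mat_B1 :: "real^'p^'n"
  mat_B2 :: "real^'q^'n"
  mat_Q :: "real^'n^'n"
  mat_QT :: "real^'n^'n"
  mat_R1 :: "real^'p^'p"
  mat_R2 :: "real^'q^'q"
  gam1 :: real
  gam2 :: real

definition lq_game_data :: "('n::finite, 'p::finite, 'q::finite) lq_game \<Rightarrow> bool" where
  "lq_game_data G \<longleftrightarrow>
     t_init G < t_final G \<and>
     pos_def (mat_Q G) \<and> pos_def (mat_QT G) \<and> pos_def (mat_R1 G) \<and> pos_def (mat_R2 G) \<and>
     stabilizable (mat_A G) (mat_B1 G) \<and> detectable (mat_A G) (mat_sqrt (mat_Q G)) \<and>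
     0 < gam1 G \<and> 0 < gam2 G"

text \<open>Stochastic kernels \<open>\<mu>\<^sub>k\<close>, one per interval; the entries beyond the number of intervals are
  irrelevant.\<close>

definition mixed_strategies ::
  "real \<Rightarrow> real list \<Rightarrow> (nat \<Rightarrow> real^'n \<Rightarrow> (real^'m) measure) set" where
  "mixed_strategies \<gamma> \<pi> = {\<mu>. \<forall>k. Suc k < length \<pi> \<longrightarrow>
     \<mu> k \<in> borel \<rightarrow>\<^sub>M prob_algebra borel \<and>
     (\<forall>x. (\<integral>\<^sup>+u. ennreal ((norm u)\<^sup>2) \<partial>\<mu> k x) \<le> ennreal (\<gamma>\<^sup>2 * (norm x)\<^sup>2))}"

text \<open>State reached from \<open>x\<close> under the constant controls \<open>u\<close>, \<open>v\<close>, as a function of the elapsed time.\<close>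

definition hold_flow ::
  "('n::finite, 'p::finite, 'q::finite) lq_game \<Rightarrow> real^'n \<Rightarrow> (real^'p) \<times> (real^'q) \<Rightarrow> real \<Rightarrow> real^'n" where
  "hold_flow G x w = (THE y. y 0 = x \<and>
     (\<forall>s. (y has_vector_derivative (mat_A G *v y s + mat_B1 G *v fst w + mat_B2 G *v snd w)) (at s)))"

text \<open>A control history \<open>h\<close> lists the pairs \<open>(u\<^sub>k, v\<^sub>k)\<close>. The state at \<open>t\<^sub>k\<close> depends only on the
  first \<open>k\<close> of them.\<close>

primrec grid_state ::
  "('n::finite, 'p::finite, 'q::finite) lq_game \<Rightarrow> real list \<Rightarrow> (nat \<Rightarrow> (real^'p) \<times> (real^'q)) \<Rightarrow> nat \<Rightarrow> real^'n" where
  "grid_state G \<pi> h 0 = x_init G"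
| "grid_state G \<pi> h (Suc k) = hold_flow G (grid_state G \<pi> h k) (h k) (\<pi> ! Suc k - \<pi> ! k)"

definition trajectory ::
  "('n::finite, 'p::finite, 'q::finite) lq_game \<Rightarrow> real list \<Rightarrow> (nat \<Rightarrow> (real^'p) \<times> (real^'q)) \<Rightarrow> real \<Rightarrow> real^'n" where
  "trajectory G \<pi> h t = (let k = interval_index \<pi> t in
     hold_flow G (grid_state G \<pi> h k) (h k) (t - \<pi> ! k))"

text \<open>Joint law of the first \<open>k\<close> control pairs: given the past, \<open>u\<^sub>k\<close> and \<open>v\<^sub>k\<close> are
  independent, with laws determined by the state at \<open>t\<^sub>k\<close>.\<close>

primrec control_law ::
  "('n::finite, 'p::finite, 'q::finite) lq_game \<Rightarrow> real list \<Rightarrow>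
   (nat \<Rightarrow> real^'n \<Rightarrow> (real^'p) measure) \<Rightarrow> (nat \<Rightarrow> real^'n \<Rightarrow> (real^'q) measure) \<Rightarrow>
   nat \<Rightarrow> (nat \<Rightarrow> (real^'p) \<times> (real^'q)) measure" where
  "control_law G \<pi> \<mu> \<nu> 0 = return (PiM {..<0} (\<lambda>_. borel)) (\<lambda>_. undefined)"
| "control_law G \<pi> \<mu> \<nu> (Suc k) = control_law G \<pi> \<mu> \<nu> k \<bind> (\<lambda>h.
     distr (\<mu> k (grid_state G \<pi> h k) \<Otimes>\<^sub>M \<nu> k (grid_state G \<pi> h k))
       (PiM {..<Suc k} (\<lambda>_. borel)) (\<lambda>w. h(k := w)))"

definition path_cost ::
  "('n::finite, 'p::finite, 'q::finite) lq_game \<Rightarrow> real list \<Rightarrow> (nat \<Rightarrow> (real^'p) \<times> (real^'q)) \<Rightarrow> real" where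
  "path_cost G \<pi> h =
     integral {t_init G..t_final G} (\<lambda>t.
       let x = trajectory G \<pi> h t; u = fst (h (interval_index \<pi> t)); v = snd (h (interval_index \<pi> t))
       in x \<bullet> (mat_Q G *v x) + u \<bullet> (mat_R1 G *v u) - v \<bullet> (mat_R2 G *v v))
     + trajectory G \<pi> h (t_final G) \<bullet> (mat_QT G *v trajectory G \<pi> h (t_final G))"

text \<open>The second-moment bounds in \<^const>\<open>mixed_strategies\<close> make the path cost integrable, so the
  default value of the Bochner integral plays no role.\<close>

definition expected_cost ::
  "('n::finite, 'p::finite, 'q::finite) lq_game \<Rightarrow> real list \<Rightarrow>
   (nat \<Rightarrow> real^'n \<Rightarrow> (real^'p) measure) \<Rightarrow> (nat \<Rightarrow> real^'n \<Rightarrow> (real^'q) measure) \<Rightarrow> real" where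
  "expected_cost G \<pi> \<mu> \<nu> = (\<integral>h. path_cost G \<pi> h \<partial>control_law G \<pi> \<mu> \<nu> (length \<pi> - 1))"

definition Q2eq ::
  "('n::finite, 'p::finite, 'q::finite) lq_game \<Rightarrow> real list \<Rightarrow> (real \<Rightarrow> real^'n^'n) \<Rightarrow> real \<Rightarrow> real^'q^'q" where
  "Q2eq G \<pi> P t = step_size \<pi> t *\<^sub>R (transpose (mat_B2 G) ** P t ** mat_B2 G) - mat_R2 G"

definition lam2 ::
  "('n::finite, 'p::finite, 'q::finite) lq_game \<Rightarrow> real list \<Rightarrow> (real \<Rightarrow> real^'n^'n) \<Rightarrow> real \<Rightarrow> real" where
  "lam2 G \<pi> P t = max 0 (lambda_max (Q2eq G \<pi> P t))"

definition K2 ::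
  "('n::finite, 'p::finite, 'q::finite) lq_game \<Rightarrow> real list \<Rightarrow> (real \<Rightarrow> real^'n^'n) \<Rightarrow> real \<Rightarrow> real^'n^'q" where
  "K2 G \<pi> P t = matrix_inv (mat_R2 G + mat (lam2 G \<pi> P t)) ** transpose (mat_B2 G) ** P t"

text \<open>The right-hand side jumps at the partition points, so a solution is continuous and solves
  the equation on each half-open interval (with the right derivative at the left end point).\<close>

definition riccati_solution ::
  "('n::finite, 'p::finite, 'q::finite) lq_game \<Rightarrow> real list \<Rightarrow> (real \<Rightarrow> real^'n^'n) \<Rightarrow> bool" where
  "riccati_solution G \<pi> P \<longleftrightarrow>
     (\<forall>t\<in>{t_init G..t_final G}. transpose (P t) = P t) \<and>
     continuous_on {t_init G..t_final G} P \<and>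
     P (t_final G) = mat_QT G \<and>
     (\<forall>k. Suc k < length \<pi> \<longrightarrow> (\<forall>t\<in>{\<pi> ! k..<\<pi> ! Suc k}.
        (P has_vector_derivative
           - (transpose (mat_A G) ** P t + P t ** mat_A G + mat_Q G
              - P t ** mat_B1 G ** matrix_inv (mat_R1 G) ** transpose (mat_B1 G) ** P t
              + P t ** mat_B2 G ** matrix_inv (mat_R2 G + mat (lam2 G \<pi> P t)) ** transpose (mat_B2 G) ** P t
              + mat (lam2 G \<pi> P t * (gam2 G)\<^sup>2)))
          (at t within {\<pi> ! k..<\<pi> ! Suc k})))"

definition capacity_conditions ::
  "('n::finite, 'p::finite, 'q::finite) lq_game \<Rightarrow> real list \<Rightarrow> (real \<Rightarrow> real^'n^'n) \<Rightarrow> bool" where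
  "capacity_conditions G \<pi> P \<longleftrightarrow> (\<forall>t\<in>{t_init G..t_final G}.
     psd (mat ((gam1 G)\<^sup>2)
       - P t ** mat_B1 G ** (matrix_inv (mat_R1 G) ** matrix_inv (mat_R1 G)) ** transpose (mat_B1 G) ** P t) \<and>
     psd (mat ((gam2 G)\<^sup>2)
       - P t ** mat_B2 G ** (matrix_inv (mat_R2 G + mat (lam2 G \<pi> P t)) ** matrix_inv (mat_R2 G + mat (lam2 G \<pi> P t)))
           ** transpose (mat_B2 G) ** P t))"

definition top_eigenvector ::
  "('n::finite, 'p::finite, 'q::finite) lq_game \<Rightarrow> real list \<Rightarrow> (real \<Rightarrow> real^'n^'n) \<Rightarrow> (real \<Rightarrow> real^'q) \<Rightarrow> bool" where
  "top_eigenvector G \<pi> P v2 \<longleftrightarrow> (\<forall>t\<in>{t_init G..t_final G}.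
     norm (v2 t) = 1 \<and> Q2eq G \<pi> P t *v v2 t = lambda_max (Q2eq G \<pi> P t) *\<^sub>R v2 t)"

definition alpha_d ::
  "('n::finite, 'p::finite, 'q::finite) lq_game \<Rightarrow> real list \<Rightarrow> (real \<Rightarrow> real^'n^'n) \<Rightarrow>
   nat \<Rightarrow> real^'n \<Rightarrow> (real^'p) measure" where
  "alpha_d G \<pi> P k x =
     gaussian (- ((matrix_inv (mat_R1 G) ** transpose (mat_B1 G) ** P (\<pi> ! k)) *v x)) 0"

definition beta_d ::
  "('n::finite, 'p::finite, 'q::finite) lq_game \<Rightarrow> real list \<Rightarrow> (real \<Rightarrow> real^'n^'n) \<Rightarrow> (real \<Rightarrow> real^'q) \<Rightarrow>
   nat \<Rightarrow> real^'n \<Rightarrow> (real^'q) measure" where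
  "beta_d G \<pi> P v2 k x =
     gaussian (K2 G \<pi> P (\<pi> ! k) *v x)
       ((x \<bullet> ((mat ((gam2 G)\<^sup>2) - transpose (K2 G \<pi> P (\<pi> ! k)) ** K2 G \<pi> P (\<pi> ! k)) *v x)
          * (if 0 < lambda_max (Q2eq G \<pi> P (\<pi> ! k)) then 1 else 0)) *\<^sub>R outer (v2 (\<pi> ! k)))"

end

theory Submission
  imports Defs
begin

text \<open>
  The capacity conditions bound the feedback gains by \<open>\<gamma>\<^sub>1\<close> and \<open>\<gamma>\<^sub>2\<close>, so the right-hand side of the
  Riccati equation grows at most linearly in \<open>P\<close> and \<open>P\<close> is bounded and Lipschitz on every partition
  interval, uniformly in the partition. Hence on fine partitions \<open>Q\<^sub>2\<^sub>,\<^sub>e\<^sub>q\<close> is negative definite, \<open>\<lambda>\<^sub>2 = 0\<close>,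
  and both synthesized strategies are deterministic linear feedbacks. Completing squares along every
  trajectory, the cost equals \<open>x\<^sub>0 \<bullet> P(t\<^sub>0) x\<^sub>0\<close> plus the integral of
  \<open>|u + K\<^sub>1 x|\<^sup>2 - |v - K\<^sub>2 x|\<^sup>2\<close>, in the norms of \<open>R\<^sub>1\<close> and \<open>R\<^sub>2\<close>. A player who uses the synthesized
  feedback makes the own square of order \<open>\<delta>\<^sup>2\<close> in expectation, because state and gain move by
  \<open>O(\<delta>)\<close> on one interval and second moments of the state are bounded uniformly over all mixed
  strategies. So each player secures \<open>x\<^sub>0 \<bullet> P(t\<^sub>0) x\<^sub>0\<close> up to the square of the mesh.
\<close>

text \<open>The solution \<open>P\<close> and the multiplier \<open>lam2\<close> change with the
  partition, so every constant has to be a function of the game data alone. For this reason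
  \<open>riccati_bound\<close>, \<open>flow_rate\<close>, \<open>sampling_error\<close> and
  \<open>moment_const\<close> are built from the whole horizon and not from a single step. The bound
  on \<open>P\<close> must also precede any use of small steps, because only this bound tells how
  small a step makes \<open>Q2eq\<close> negative. It therefore has to cope with positive
  \<open>lam2\<close>, which the Rayleigh quotient at \<open>v2\<close> estimates linearly in
  \<open>P\<close>. The completed square is an identity along each trajectory for arbitrary held
  controls. A deviation of the opponent thus needs no optimality argument: the opponent's square has
  a favourable sign and is dropped. Admissibility is claimed on coarse partitions too, where the
  noise of the maximizer may be present; the second moments of singular Gaussian laws serve that
  claim. The exponent 1/2 results from the square of the mesh because the mesh is kept below
  1.\<close>

section \<open>Matrix norms and positive definite matrices\<close>

text \<open>The norm of this matrix type is the Euclidean norm of the entries, so Cauchy-Schwarz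
  applies row by row.\<close>

lemma norm_matrix_vector_mult_le:
  fixes M :: "real^'n^'m"
  shows "norm (M *v x) \<le> norm M * norm x"
proof -
  have "norm (M *v x) \<le> L2_set (\<lambda>i. norm (M $ i) * norm x) UNIV"
    unfolding norm_vec_def[of "M *v x"]
    by (rule L2_set_mono) (auto simp: matrix_vector_mul_component Cauchy_Schwarz_ineq2)
  also have "\<dots> = norm M * norm x"
    by (simp add: norm_vec_def[of M] L2_set_left_distrib)
  finally show ?thesis .
qed

lemma norm_transpose [simp]: "norm (transpose M) = norm (M :: real^'n^'m)"
proof -
  have "(norm (transpose M))\<^sup>2 = (norm M)\<^sup>2"
    unfolding power2_norm_eq_inner inner_vec_def transpose_def
    by (simp add: inner_real_def) (rule sum.swap)
  then show ?thesis
    by simp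
qed

lemma norm_matrix_mult_le:
  fixes M :: "real^'n^'m" and N :: "real^'k^'n"
  shows "norm (M ** N) \<le> norm M * norm N"
proof -
  have row: "(M ** N) $ i = transpose N *v (M $ i)" for i
    by (simp add: matrix_matrix_mult_def matrix_vector_mult_def transpose_def vec_eq_iff mult.commute)
  have "norm ((M ** N) $ i) \<le> norm (M $ i) * norm N" for i
    using norm_matrix_vector_mult_le[of "transpose N" "M $ i"] unfolding row
    by (simp add: mult.commute del: transpose_matrix_vector)
  then have "norm (M ** N) \<le> L2_set (\<lambda>i. norm (M $ i) * norm N) UNIV"
    unfolding norm_vec_def[of "M ** N"] by (intro L2_set_mono) auto
  also have "\<dots> = norm M * norm N"
    by (simp add: norm_vec_def[of M] L2_set_left_distrib)
  finally show ?thesis .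
qed

text \<open>The capacity conditions control the gains as operators, while the Riccati estimates use
  the entrywise norm. Each column is the image of a unit vector and has norm at most
  \<open>g\<close>; adding the columns costs the factor \<open>CARD('n)\<close>.\<close>

lemma norm_matrix_le_of_operator_bound:
  fixes M :: "real^'n^'m"
  assumes "\<And>x. norm (M *v x) \<le> g * norm x"
  shows "norm M \<le> real CARD('n) * g"
proof -
  have "norm (transpose M) \<le> (\<Sum>j\<in>UNIV. norm (transpose M $ j))"
    unfolding norm_vec_def[of "transpose M"] by (rule L2_set_le_sum) simp
  also have "\<dots> \<le> (\<Sum>j\<in>(UNIV::'n set). (g::real))"
  proof (rule sum_mono)
    fix j :: 'n
    have "transpose M $ j = M *v axis j 1"
      by (simp add: matrix_vector_mult_basis column_def transpose_def vec_eq_iff)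
    then show "norm (transpose M $ j) \<le> g"
      using assms[of "axis j 1"] by simp
  qed
  finally show ?thesis by simp
qed

lemma mat_vector_mult [simp]: "mat c *v x = c *\<^sub>R (x :: real^'n)"
  by (simp add: mat_def matrix_vector_mult_def vec_eq_iff if_distrib[of "\<lambda>z. z * _"] cong: if_cong)

lemma mat_zero: "mat 0 = (0 :: real^'n^'n)"
  by (simp add: mat_def vec_eq_iff)

lemma norm_mat_le: "norm (mat c :: real^'n^'n) \<le> real CARD('n) * \<bar>c\<bar>"
  by (rule norm_matrix_le_of_operator_bound) simp

lemma bounded_bilinear_matrix_vector:
  "bounded_bilinear (\<lambda>(M :: real^'n^'m) x. M *v x)"
proof (unfold_locales)
  show "\<exists>K. \<forall>(M :: real^'n^'m) x. norm (M *v x) \<le> norm M * norm x * K"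
    by (rule exI[of _ 1]) (simp add: norm_matrix_vector_mult_le)
qed (simp_all add: matrix_vector_mult_add_rdistrib matrix_vector_right_distrib
      matrix_vector_mult_scaleR scaleR_matrix_vector_assoc)

lemma inner_matrix_transpose: "x \<bullet> (M *v y) = (transpose M *v x) \<bullet> (y :: real^'n)"
  for M :: "real^'n^'m"
  by (simp add: dot_lmul_matrix)

lemma quadratic_form_le: "\<bar>x \<bullet> (M *v x)\<bar> \<le> norm M * (norm (x :: real^'n))\<^sup>2"
proof -
  have "\<bar>x \<bullet> (M *v x)\<bar> \<le> norm x * norm (M *v x)"
    by (rule Cauchy_Schwarz_ineq2)
  also have "\<dots> \<le> norm x * (norm M * norm x)"
    by (intro mult_left_mono norm_matrix_vector_mult_le) simp
  finally show ?thesis by (simp add: power2_eq_square mult_ac)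
qed

text \<open>By homogeneity it is enough to minimize the quadratic form on the unit sphere, where
  compactness gives a minimizer and the minimum is positive.\<close>

lemma pos_def_coercive:
  fixes R :: "real^'n^'n"
  assumes "pos_def R"
  obtains r where "r > 0" "\<And>x. r * (norm x)\<^sup>2 \<le> x \<bullet> (R *v x)"
proof -
  let ?S = "sphere (0 :: real^'n) 1"
  have "?S \<noteq> {}" 
    using norm_axis_1 by (metis empty_iff mem_sphere_0)
  moreover have "continuous_on ?S (\<lambda>y. y \<bullet> (R *v y))"
    by (intro continuous_intros linear_continuous_on matrix_vector_mul_bounded_linear)
  ultimately obtain x0 where x0: "x0 \<in> ?S" "\<And>y. y \<in> ?S \<Longrightarrow> x0 \<bullet> (R *v x0) \<le> y \<bullet> (R *v y)"
    using continuous_attains_inf[of ?S "\<lambda>y. y \<bullet> (R *v y)"] by auto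
  show thesis
  proof
    show "0 < x0 \<bullet> (R *v x0)"
      using assms x0(1) unfolding pos_def_def by (metis mem_sphere_0 norm_zero zero_neq_one)
    show "x0 \<bullet> (R *v x0) * (norm x)\<^sup>2 \<le> x \<bullet> (R *v x)" for x
    proof (cases "x = 0")
      case False
      let ?y = "x /\<^sub>R norm x"
      have "x0 \<bullet> (R *v x0) \<le> ?y \<bullet> (R *v ?y)"
        using False by (intro x0(2)) simp
      also have "?y \<bullet> (R *v ?y) = (x \<bullet> (R *v x)) / (norm x)\<^sup>2"
        by (simp add: matrix_vector_mult_scaleR power2_eq_square divide_inverse)
      finally show ?thesis using False by (simp add: field_simps)
    qed simp
  qed
qed

lemma pos_def_invertible:
  fixes R :: "real^'n^'n"
  assumes "pos_def R"
  shows "invertible R"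
proof -
  have "inj ((*v) R)"
  proof (rule injI)
    fix x y assume "R *v x = R *v y"
    then have "(x - y) \<bullet> (R *v (x - y)) = 0"
      by (simp add: matrix_vector_mult_diff_distrib)
    then show "x = y"
      using assms unfolding pos_def_def by (metis eq_iff_diff_eq_0 less_irrefl)
  qed
  then show ?thesis
    by (simp add: invertible_left_inverse matrix_left_invertible_injective)
qed

lemma pos_def_inverse:
  fixes R :: "real^'n^'n"
  assumes "pos_def R"
  shows "R ** matrix_inv R = mat 1" "matrix_inv R ** R = mat 1"
  using someI_ex[OF pos_def_invertible[OF assms, unfolded invertible_def]]
  unfolding matrix_inv_def by auto

lemma pos_def_inverse_symmetric:
  fixes R :: "real^'n^'n"
  assumes "pos_def R"
  shows "transpose (matrix_inv R) = matrix_inv R"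
proof -
  have "transpose (matrix_inv R) ** R = mat 1"
    using arg_cong[OF pos_def_inverse(1)[OF assms], of transpose] assms
    by (simp add: matrix_transpose_mul pos_def_def)
  then have "transpose (matrix_inv R) ** R ** matrix_inv R = matrix_inv R"
    by simp
  then show ?thesis
    by (simp add: pos_def_inverse(1)[OF assms] flip: matrix_mul_assoc)
qed

lemma transpose_mat [simp]: "transpose (mat c) = mat c"
  by (auto simp: transpose_def mat_def vec_eq_iff)

lemma pos_def_add_mat:
  fixes R :: "real^'n^'n"
  assumes "pos_def R" "0 \<le> l"
  shows "pos_def (R + mat l)"
proof -
  have "transpose (R + mat l) = transpose R + transpose (mat l)"
    by (simp add: transpose_def vec_eq_iff)
  moreover have "x \<bullet> ((R + mat l) *v x) = x \<bullet> (R *v x) + l * (norm x)\<^sup>2" for x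
    by (simp add: matrix_vector_mult_add_rdistrib inner_add_right power2_norm_eq_inner)
  ultimately show ?thesis
    using assms unfolding pos_def_def by (auto intro: add_pos_nonneg)
qed

text \<open>The subtracted matrix is \<open>transpose K ** K\<close> with
  \<open>K = S ** transpose B ** P\<close>. A capacity condition is therefore the bound
  \<open>g\<close> on the operator norm of the gain \<open>K\<close>.\<close>

lemma quadratic_form_capacity:
  fixes P :: "real^'n^'n" and B :: "real^'m^'n" and S :: "real^'m^'m"
  assumes "transpose P = P" "transpose S = S"
  shows "x \<bullet> ((mat (g\<^sup>2) - P ** B ** (S ** S) ** transpose B ** P) *v x)
    = g\<^sup>2 * (norm x)\<^sup>2 - (norm ((S ** transpose B ** P) *v x))\<^sup>2"
proof -
  let ?K = "S ** transpose B ** P"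
  have "P ** B ** (S ** S) ** transpose B ** P = transpose ?K ** ?K"
    using assms by (simp add: matrix_transpose_mul matrix_mul_assoc)
  moreover have "x \<bullet> ((transpose ?K ** ?K) *v x) = (norm (?K *v x))\<^sup>2"
    by (simp only: inner_matrix_transpose power2_norm_eq_inner transpose_transpose flip: matrix_vector_mul_assoc)
  ultimately show ?thesis
    by (simp add: matrix_vector_mult_diff_rdistrib inner_diff_right power2_norm_eq_inner)
qed

section \<open>Square roots of rank-one matrices\<close>

lemma outer_mult_vector: "outer v *v x = (v \<bullet> x) *\<^sub>R v"
  by (simp add: outer_def matrix_vector_mult_def inner_vec_def vec_eq_iff sum_distrib_left sum_distrib_right mult_ac)

lemma transpose_outer: "transpose (outer v) = outer v"
  by (simp add: outer_def transpose_def vec_eq_iff mult.commute)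

lemma psd_scaleR_outer: "0 \<le> c \<Longrightarrow> psd (c *\<^sub>R outer v)"
  unfolding psd_def
  by (auto simp: transpose_scalar transpose_outer outer_mult_vector inner_commute mult.assoc
      simp flip: scaleR_matrix_vector_assoc)

text \<open>\<open>mat_sqrt\<close> is a definite description, so its value needs uniqueness of the
  root. For \<open>w\<close> orthogonal to \<open>v\<close>, symmetry makes the squared norm of
  \<open>S *v w\<close> equal to \<open>w \<bullet> (S *v (S *v w)) = 0\<close>. Hence
  \<open>S\<close> vanishes on the complement of \<open>v\<close>, maps \<open>v\<close> to a
  nonnegative multiple of itself, and squaring determines the multiple.\<close>

lemma psd_sqrt_outer_unique:
  fixes S :: "real^'n^'n"
  assumes S: "psd S" "S ** S = c *\<^sub>R outer v" and v: "norm v = 1" and c: "0 \<le> c"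
  shows "S = sqrt c *\<^sub>R outer v"
proof -
  have symS: "x \<bullet> (S *v y) = (S *v x) \<bullet> y" for x y
    using S(1) by (simp add: inner_matrix_transpose psd_def)
  have SS: "S *v (S *v x) = (c * (v \<bullet> x)) *\<^sub>R v" for x
    by (simp add: matrix_vector_mul_assoc S(2) outer_mult_vector flip: scaleR_matrix_vector_assoc)
  have vv: "v \<bullet> v = 1"
    using v by (simp add: norm_eq_1)
  have orth: "S *v w = 0" if "v \<bullet> w = 0" for w
  proof -
    have "(S *v w) \<bullet> (S *v w) = 0"
      using symS[of w "S *v w"] SS[of w] that by simp
    then show ?thesis by simp
  qed
  define s where "s = v \<bullet> (S *v v)"
  have Sv: "S *v v = s *\<^sub>R v"
  proof -
    let ?w = "S *v v - s *\<^sub>R v"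
    have w: "v \<bullet> ?w = 0"
      by (simp add: inner_diff_right s_def vv)
    then have "(S *v v) \<bullet> ?w = 0"
      using symS[of v ?w] orth[OF w] by simp
    then have "?w \<bullet> ?w = 0"
      using w by (simp add: inner_diff_left)
    then show ?thesis by simp
  qed
  have "s \<ge> 0"
    using S(1) unfolding s_def psd_def by blast
  moreover have "s\<^sup>2 = c"
    using SS[of v] Sv vv v by (simp add: matrix_vector_mult_scaleR power2_eq_square) (metis norm_zero zero_neq_one)
  ultimately have s: "s = sqrt c"
    by (simp add: real_sqrt_unique)
  have "S *v x = (sqrt c *\<^sub>R outer v) *v x" for x
  proof -
    have "S *v x = S *v (x - (v \<bullet> x) *\<^sub>R v) + (v \<bullet> x) *\<^sub>R (S *v v)"
      by (simp add: matrix_vector_mult_diff_distrib matrix_vector_mult_scaleR)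
    also have "S *v (x - (v \<bullet> x) *\<^sub>R v) = 0"
      by (rule orth) (simp add: inner_diff_right vv)
    finally show ?thesis
      by (simp add: Sv s outer_mult_vector mult.commute flip: scaleR_matrix_vector_assoc)
  qed
  then show ?thesis
    by (simp add: matrix_eq)
qed

lemma mat_sqrt_scaleR_outer:
  fixes v :: "real^'n"
  assumes "norm v = 1" "0 \<le> c"
  shows "mat_sqrt (c *\<^sub>R outer v) = sqrt c *\<^sub>R outer v"
  unfolding mat_sqrt_def
proof (rule the_equality)
  have "v \<bullet> v = 1"
    using assms(1) by (simp add: norm_eq_1)
  then have "(sqrt c *\<^sub>R outer v ** sqrt c *\<^sub>R outer v) *v x = (c *\<^sub>R outer v) *v x" for x
    using assms(2)
    by (simp add: outer_mult_vector matrix_vector_mult_scaleR flip: matrix_vector_mul_assoc scaleR_matrix_vector_assoc)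
  then have "sqrt c *\<^sub>R outer v ** sqrt c *\<^sub>R outer v = c *\<^sub>R outer v"
    by (simp add: matrix_eq)
  then show "psd (sqrt c *\<^sub>R outer v) \<and> sqrt c *\<^sub>R outer v ** sqrt c *\<^sub>R outer v = c *\<^sub>R outer v"
    by (simp add: psd_scaleR_outer assms)
qed (use psd_sqrt_outer_unique assms in blast)

subsection \<open>Gaussian laws of rank at most one\<close>

definition std_normal_measure :: "real measure" where
  "std_normal_measure = density lborel (\<lambda>x. ennreal (std_normal_density x))"

lemma prob_space_std_normal_measure: "prob_space std_normal_measure"
  unfolding std_normal_measure_def by (rule prob_space_normal_density) simp

lemma sets_std_normal_measure [simp, measurable_cong]: "sets std_normal_measure = sets borel"
  by (simp add: std_normal_measure_def)

lemma space_std_normal_measure [simp]: "space std_normal_measure = UNIV"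
  by (simp add: std_normal_measure_def)

lemma std_normal_measure_power:
  "integrable std_normal_measure (\<lambda>x. x ^ k)"
  "(\<integral>x. x ^ k \<partial>std_normal_measure) = (\<integral>x. std_normal_density x * x ^ k \<partial>lborel)"
  unfolding std_normal_measure_def
  by (auto simp: integrable_density integral_density integrable_std_normal_moment)

lemma std_normal_measure_moments:
  "integrable std_normal_measure (\<lambda>x. x)" "(\<integral>x. x \<partial>std_normal_measure) = 0"
  "integrable std_normal_measure (\<lambda>x. x * x)" "(\<integral>x. x * x \<partial>std_normal_measure) = 1"
  using std_normal_measure_power[of 1] std_normal_measure_power[of 2]
    integral_std_normal_moment_odd[of 0] integral_std_normal_moment_even[of 1]
  by (simp_all add: power2_eq_square)

lemma measurable_vec_lambda_borel:
  assumes "\<And>i. (\<lambda>x. f x i) \<in> borel_measurable M"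
  shows "(\<lambda>x. (\<chi> i. f x i) :: real^'n) \<in> borel_measurable M"
  by (subst borel_measurable_euclidean_space) (auto simp: Basis_vec_def inner_axis assms)

lemma std_gaussian_eq:
  "std_gaussian = distr (PiM UNIV (\<lambda>_. std_normal_measure)) borel (\<lambda>z. (\<chi> i. z i) :: real^'n)"
  unfolding std_gaussian_def std_normal_measure_def ..

lemma measurable_PiM_vec_lambda [measurable]:
  "(\<lambda>z. (\<chi> i. z i) :: real^'n) \<in> borel_measurable (PiM UNIV (\<lambda>_. std_normal_measure))"
  by (intro measurable_vec_lambda_borel) measurable

lemma prob_space_std_gaussian: "prob_space (std_gaussian :: (real^'n) measure)"
proof -
  interpret N: prob_space std_normal_measure
    by (rule prob_space_std_normal_measure)
  interpret product_prob_space "\<lambda>_. std_normal_measure" "UNIV :: 'n set" ..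
  show ?thesis
    unfolding std_gaussian_eq by (intro prob_space.prob_space_distr P.prob_space_axioms measurable_PiM_vec_lambda)
qed

lemma sets_std_gaussian [simp, measurable_cong]: "sets std_gaussian = sets borel"
  by (simp add: std_gaussian_def)

lemma space_std_gaussian [simp]: "space std_gaussian = UNIV"
  by (simp add: std_gaussian_def)

text \<open>\<open>z $ i\<close> and \<open>z $ i * z $ j\<close> are products over all coordinates
  of one-variable functions, constantly 1 at the remaining coordinates. The integral of such a
  product factors, which leaves moments of the scalar normal law.\<close>

lemma std_gaussian_moments:
  fixes i j :: "'n::finite"
  shows "integrable (std_gaussian :: (real^'n) measure) (\<lambda>z. z $ i)"
    and "(\<integral>z. z $ i \<partial>(std_gaussian :: (real^'n) measure)) = 0"
    and "integrable (std_gaussian :: (real^'n) measure) (\<lambda>z. z $ i * z $ j)"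
    and "(\<integral>z. z $ i * z $ j \<partial>(std_gaussian :: (real^'n) measure)) = (if i = j then 1 else 0)"
proof -
  interpret N: prob_space std_normal_measure
    by (rule prob_space_std_normal_measure)
  interpret product_prob_space "\<lambda>_. std_normal_measure" "UNIV :: 'n set" ..
  let ?g = "\<lambda>i k x. if k = i then x else (1::real)"
  let ?h = "\<lambda>k x. ?g i k x * ?g j k x"
  have prodg: "(\<Prod>k\<in>UNIV. ?g i k (z k)) = z i" for i :: 'n and z
    by simp
  have prodh: "(\<Prod>k\<in>UNIV. ?h k (z k)) = z i * z j" for z
    by (simp add: prod.distrib)
  have intg: "integrable std_normal_measure (?g i k)" for k
    using std_normal_measure_moments by (cases "k = i") auto
  have inth: "integrable std_normal_measure (?h k)" for k
    using std_normal_measure_moments by (cases "k = i"; cases "k = j") auto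
  have Eg: "(\<Prod>k\<in>UNIV. \<integral>x. ?g i k x \<partial>std_normal_measure) = 0"
    by (intro prod_zero bexI[of _ i]) (simp_all add: std_normal_measure_moments)
  have Eh: "(\<Prod>k\<in>UNIV. \<integral>x. ?h k x \<partial>std_normal_measure) = (if i = j then 1 else 0)"
  proof (cases "i = j")
    case True
    have "(\<integral>x. ?h k x \<partial>std_normal_measure) = 1" for k
      using True std_normal_measure_moments N.prob_space by (cases "k = i") auto
    then show ?thesis using True by simp
  next
    case False
    then show ?thesis
      by (simp only: if_False, intro prod_zero bexI[of _ i]) (simp_all add: std_normal_measure_moments)
  qed
  note ig = product_integrable_prod[of UNIV "?g i", OF finite intg]
    product_integral_prod[of UNIV "?g i", OF finite intg]
  note ih = product_integrable_prod[of UNIV ?h, OF finite inth]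
    product_integral_prod[of UNIV ?h, OF finite inth]
  show "integrable (std_gaussian :: (real^'n) measure) (\<lambda>z. z $ i)"
    unfolding std_gaussian_eq using ig(1) by (subst integrable_distr_eq) (auto simp: prodg)
  show "(\<integral>z. z $ i \<partial>(std_gaussian :: (real^'n) measure)) = 0"
    unfolding std_gaussian_eq using ig(2) Eg by (subst integral_distr) (auto simp: prodg)
  show "integrable (std_gaussian :: (real^'n) measure) (\<lambda>z. z $ i * z $ j)"
    unfolding std_gaussian_eq using ih(1) by (subst integrable_distr_eq) (auto simp: prodh)
  show "(\<integral>z. z $ i * z $ j \<partial>(std_gaussian :: (real^'n) measure)) = (if i = j then 1 else 0)"
    unfolding std_gaussian_eq using ih(2) Eh by (subst integral_distr) (auto simp: prodh)
qed

lemma std_gaussian_inner_moments: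
  fixes v :: "real^'n"
  shows "integrable std_gaussian (\<lambda>z. v \<bullet> z)" and "(\<integral>z. v \<bullet> z \<partial>std_gaussian) = 0"
    and "integrable std_gaussian (\<lambda>z. (v \<bullet> z)\<^sup>2)" and "(\<integral>z. (v \<bullet> z)\<^sup>2 \<partial>std_gaussian) = (norm v)\<^sup>2"
proof -
  have v: "v \<bullet> z = (\<Sum>i\<in>UNIV. v $ i * z $ i)" for z
    by (simp add: inner_vec_def)
  have vv: "(v \<bullet> z)\<^sup>2 = (\<Sum>i\<in>UNIV. \<Sum>j\<in>UNIV. v $ i * v $ j * (z $ i * z $ j))" for z
    by (simp add: v power2_eq_square sum_product mult_ac)
  show "integrable std_gaussian (\<lambda>z. v \<bullet> z)" "(\<integral>z. v \<bullet> z \<partial>std_gaussian) = 0"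
    unfolding v by (simp_all add: std_gaussian_moments)
  show "integrable std_gaussian (\<lambda>z. (v \<bullet> z)\<^sup>2)"
    unfolding vv by (simp add: std_gaussian_moments)
  show "(\<integral>z. (v \<bullet> z)\<^sup>2 \<partial>std_gaussian) = (norm v)\<^sup>2"
    unfolding vv
    by (simp add: std_gaussian_moments Bochner_Integration.integral_sum if_distrib
        power2_norm_eq_inner inner_vec_def cong: if_cong)
qed

text \<open>With the root evaluated, the randomness is the scalar variable
  \<open>v \<bullet> z\<close> along a fixed direction. The parameters enter only through
  \<open>m\<close> and \<open>sqrt c\<close>, which opens the way to second moments and to
  measurability in the state.\<close>

lemma gaussian_outer:
  fixes m v :: "real^'n"
  assumes "norm v = 1" "0 \<le> c"
  shows "gaussian m (c *\<^sub>R outer v) = distr std_gaussian borel (\<lambda>z. m + (sqrt c * (v \<bullet> z)) *\<^sub>R v)"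
  unfolding gaussian_def
  by (simp add: mat_sqrt_scaleR_outer[OF assms] outer_mult_vector flip: scaleR_matrix_vector_assoc)

text \<open>The zero matrix is a rank-one covariance with \<open>c = 0\<close> for any unit vector,
  so no separate root of 0 has to be found.\<close>

lemma gaussian_zero: "gaussian m 0 = return borel (m :: real^'n)"
proof -
  interpret prob_space "std_gaussian :: (real^'n) measure"
    by (rule prob_space_std_gaussian)
  obtain v :: "real^'n" where "norm v = 1"
    using norm_axis_1 by blast
  from gaussian_outer[OF this, of 0 m]
  have "gaussian m 0 = distr (std_gaussian :: (real^'n) measure) borel (\<lambda>z. m)"
    by (simp del: distr_const)
  then show ?thesis
    by simp
qed

text \<open>The cross term is a multiple of the centered variable \<open>v \<bullet> z\<close>,
  whose square has mean 1.\<close>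

lemma gaussian_outer_second_moment:
  fixes m v :: "real^'n"
  assumes v: "norm v = 1" and c: "0 \<le> c"
  shows "(\<integral>\<^sup>+u. ennreal ((norm u)\<^sup>2) \<partial>gaussian m (c *\<^sub>R outer v)) = ennreal ((norm m)\<^sup>2 + c)"
proof -
  interpret prob_space "std_gaussian :: (real^'n) measure"
    by (rule prob_space_std_gaussian)
  let ?f = "\<lambda>z. (norm m)\<^sup>2 + 2 * sqrt c * (m \<bullet> v) * (v \<bullet> z) + c * (v \<bullet> z)\<^sup>2"
  have vv: "v \<bullet> v = 1"
    using v by (simp add: norm_eq_1)
  have eq: "(norm (m + (sqrt c * (v \<bullet> z)) *\<^sub>R v))\<^sup>2 = ?f z" for z
    using c vv real_sqrt_mult_self[of c]
    by (simp only: power2_norm_eq_inner)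
      (simp add: inner_add_left inner_add_right inner_commute algebra_simps power2_eq_square power_mult_distrib)
  have "(\<integral>\<^sup>+u. ennreal ((norm u)\<^sup>2) \<partial>gaussian m (c *\<^sub>R outer v)) = (\<integral>\<^sup>+z. ennreal (?f z) \<partial>std_gaussian)"
    unfolding gaussian_outer[OF assms] by (subst nn_integral_distr) (simp_all flip: eq)
  also have "\<dots> = ennreal (\<integral>z. ?f z \<partial>std_gaussian)"
  proof (rule nn_integral_eq_integral)
    show "integrable std_gaussian ?f"
      by (simp add: std_gaussian_inner_moments)
  qed (simp flip: eq)
  also have "(\<integral>z. ?f z \<partial>std_gaussian) = (norm m)\<^sup>2 + c"
    using v prob_space by (simp add: std_gaussian_inner_moments)
  finally show ?thesis .
qed

text \<open>All these laws are images of one fixed measure under a map that is jointly measurable in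
  state and noise.\<close>

lemma gaussian_outer_kernel:
  fixes K :: "real^'n^'m"
  assumes v: "norm v = 1" and c: "\<And>x. 0 \<le> c x" and cm [measurable]: "c \<in> borel_measurable borel"
  shows "(\<lambda>x. gaussian (K *v x) (c x *\<^sub>R outer v)) \<in> borel \<rightarrow>\<^sub>M prob_algebra borel"
proof (rule measurable_prob_algebraI)
  interpret prob_space "std_gaussian :: (real^'m) measure"
    by (rule prob_space_std_gaussian)
  have [measurable]: "(\<lambda>x. K *v x) \<in> borel_measurable borel"
    by (intro borel_measurable_continuous_onI linear_continuous_on matrix_vector_mul_bounded_linear)
  show "prob_space (gaussian (K *v x) (c x *\<^sub>R outer v))" for x
    unfolding gaussian_outer[OF v c] by (rule prob_space_distr) measurable
  show "(\<lambda>x. gaussian (K *v x) (c x *\<^sub>R outer v)) \<in> borel \<rightarrow>\<^sub>M subprob_algebra borel"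
    unfolding gaussian_outer[OF v c]
  proof (rule measurable_distr2)
    show "(\<lambda>x. std_gaussian) \<in> borel \<rightarrow>\<^sub>M subprob_algebra (std_gaussian :: (real^'m) measure)"
      by (intro measurable_const M_in_subprob)
  qed (simp add: split_beta', measurable)
qed

subsection \<open>Admissibility\<close>

lemma matrix_gain_bound:
  assumes "psd (mat (g\<^sup>2) - P ** B ** (S ** S) ** transpose B ** P)"
    and "transpose P = P" "transpose S = S" "0 \<le> g"
  shows "norm ((S ** transpose B ** P) *v x) \<le> g * norm x"
proof -
  have "0 \<le> g\<^sup>2 * (norm x)\<^sup>2 - (norm ((S ** transpose B ** P) *v x))\<^sup>2"
    using assms(1) unfolding psd_def quadratic_form_capacity[OF assms(2,3), symmetric] by blast
  then have "(norm ((S ** transpose B ** P) *v x))\<^sup>2 \<le> (g * norm x)\<^sup>2"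
    by (simp add: power_mult_distrib)
  then show ?thesis
    by (rule power2_le_imp_le) (simp add: assms(4))
qed

definition K1 :: "('n::finite, 'p::finite, 'q::finite) lq_game \<Rightarrow> (real \<Rightarrow> real^'n^'n) \<Rightarrow> real \<Rightarrow> real^'n^'p" where
  "K1 G P t = matrix_inv (mat_R1 G) ** transpose (mat_B1 G) ** P t"

lemma gain_bounds:
  assumes "lq_game_data G" "riccati_solution G \<pi> P" "capacity_conditions G \<pi> P"
    and t: "t \<in> {t_init G..t_final G}"
  shows "norm (K1 G P t *v x) \<le> gam1 G * norm x" and "norm (K2 G \<pi> P t *v x) \<le> gam2 G * norm x"
proof -
  have P: "transpose (P t) = P t"
    using assms(2) t unfolding riccati_solution_def by blast
  have R: "pos_def (mat_R1 G)" "pos_def (mat_R2 G + mat (lam2 G \<pi> P t))"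
    using assms(1) unfolding lq_game_data_def by (auto intro!: pos_def_add_mat simp: lam2_def)
  show "norm (K1 G P t *v x) \<le> gam1 G * norm x" "norm (K2 G \<pi> P t *v x) \<le> gam2 G * norm x"
    using assms t unfolding K1_def K2_def capacity_conditions_def lq_game_data_def
    by (auto intro!: matrix_gain_bound P pos_def_inverse_symmetric R)
qed

lemma alpha_d_eq: "alpha_d G \<pi> P k x = return borel (- (K1 G P (\<pi> ! k) *v x))"
  by (simp add: alpha_d_def gaussian_zero K1_def)

lemma partition_nth_bounds:
  assumes "partition_of a b \<pi>" "k < length \<pi>"
  shows "a \<le> \<pi> ! k" "\<pi> ! k \<le> b"
proof -
  have mono: "i < j \<Longrightarrow> j < length \<pi> \<Longrightarrow> \<pi> ! i < \<pi> ! j" for i j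
    using assms unfolding partition_of_def sorted_wrt_iff_nth_less by blast
  have "\<pi> ! 0 = a" "\<pi> ! (length \<pi> - 1) = b"
    using assms unfolding partition_of_def by (auto simp: hd_conv_nth last_conv_nth)
  with mono[of 0 k] mono[of k "length \<pi> - 1"] assms(2) show "a \<le> \<pi> ! k" "\<pi> ! k \<le> b"
    by (cases "k = 0"; cases "k = length \<pi> - 1"; force)+
qed

lemma return_kernel_mixed_strategies:
  fixes K :: "nat \<Rightarrow> real^'n^'m"
  assumes "\<And>k x. Suc k < length \<pi> \<Longrightarrow> norm (K k *v x) \<le> g * norm x" 
  shows "(\<lambda>k x. return borel (K k *v x)) \<in> mixed_strategies g \<pi>"
  unfolding mixed_strategies_def
proof (intro CollectI allI impI conjI)
  fix k assume k: "Suc k < length \<pi>"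
  have [measurable]: "(\<lambda>x. K k *v x) \<in> borel_measurable borel"
    by (intro borel_measurable_continuous_onI linear_continuous_on matrix_vector_mul_bounded_linear)
  show "(\<lambda>x. return borel (K k *v x)) \<in> borel \<rightarrow>\<^sub>M prob_algebra borel"
    by measurable
  show "(\<integral>\<^sup>+u. ennreal ((norm u)\<^sup>2) \<partial>return borel (K k *v x)) \<le> ennreal (g\<^sup>2 * (norm x)\<^sup>2)" for x
    using assms[OF k, of x] 
    by (subst nn_integral_return) (auto intro!: ennreal_leI power_mono simp flip: power_mult_distrib)
qed

lemma matrix_vector_mult_minus_left: "(- M) *v x = - (M *v (x :: real^'n))"
  by (simp add: matrix_vector_mult_def vec_eq_iff sum_negf)

lemma alpha_d_mixed:
  assumes "lq_game_data G" "riccati_solution G \<pi> P" "capacity_conditions G \<pi> P"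
    and "partition_of (t_init G) (t_final G) \<pi>"
  shows "alpha_d G \<pi> P \<in> mixed_strategies (gam1 G) \<pi>"
proof -
  have "norm ((- K1 G P (\<pi> ! k)) *v x) \<le> gam1 G * norm x" if "Suc k < length \<pi>" for k x
    using gain_bounds(1)[OF assms(1-3)] partition_nth_bounds[OF assms(4), of k] that
    by (simp add: matrix_vector_mult_minus_left)
  from return_kernel_mixed_strategies[of \<pi> "\<lambda>k. - K1 G P (\<pi> ! k)", OF this] show ?thesis
    by (simp add: alpha_d_eq[abs_def] matrix_vector_mult_minus_left)
qed

text \<open>The variance along \<open>v2\<close> is the slack of the capacity condition. It is
  nonnegative by the gain bound, and when the noise is switched on, mean and variance together
  exhaust the second-moment budget of the maximizer.\<close>

lemma beta_d_mixed:
  assumes "lq_game_data G" "riccati_solution G \<pi> P" "capacity_conditions G \<pi> P"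
    and "partition_of (t_init G) (t_final G) \<pi>" and "top_eigenvector G \<pi> P v2"
  shows "beta_d G \<pi> P v2 \<in> mixed_strategies (gam2 G) \<pi>"
  unfolding mixed_strategies_def
proof (intro CollectI allI impI conjI)
  fix k assume k: "Suc k < length \<pi>"
  then have t: "\<pi> ! k \<in> {t_init G..t_final G}"
    using partition_nth_bounds[OF assms(4), of k] by simp
  let ?K = "K2 G \<pi> P (\<pi> ! k)"
  let ?b = "if 0 < lambda_max (Q2eq G \<pi> P (\<pi> ! k)) then 1 else 0 :: real"
  define c where "c x = x \<bullet> ((mat ((gam2 G)\<^sup>2) - transpose ?K ** ?K) *v x) * ?b" for x
  have v: "norm (v2 (\<pi> ! k)) = 1"
    using assms(5) t unfolding top_eigenvector_def by blast
  have "x \<bullet> ((transpose ?K ** ?K) *v x) = (norm (?K *v x))\<^sup>2" for x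
    by (simp only: inner_matrix_transpose power2_norm_eq_inner transpose_transpose flip: matrix_vector_mul_assoc)
  then have c_eq: "c x = ((gam2 G)\<^sup>2 * (norm x)\<^sup>2 - (norm (?K *v x))\<^sup>2) * ?b" for x
    unfolding c_def by (simp add: matrix_vector_mult_diff_rdistrib inner_diff_right power2_norm_eq_inner)
  have Kx: "(norm (?K *v x))\<^sup>2 \<le> (gam2 G)\<^sup>2 * (norm x)\<^sup>2" for x
    using power_mono[OF gain_bounds(2)[OF assms(1-3) t, of x], of 2] by (simp add: power_mult_distrib)
  have c: "0 \<le> c x" "(norm (?K *v x))\<^sup>2 + c x \<le> (gam2 G)\<^sup>2 * (norm x)\<^sup>2" for x
    using Kx[of x] by (simp_all add: c_eq)
  have [measurable]: "(\<lambda>x. ?K *v x) \<in> borel_measurable borel"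
    by (intro borel_measurable_continuous_onI linear_continuous_on matrix_vector_mul_bounded_linear)
  have cm: "c \<in> borel_measurable borel"
    unfolding c_eq[abs_def] by measurable
  have eq: "beta_d G \<pi> P v2 k = (\<lambda>x. gaussian (?K *v x) (c x *\<^sub>R outer (v2 (\<pi> ! k))))"
    by (simp add: beta_d_def[abs_def] c_def)
  show "beta_d G \<pi> P v2 k \<in> borel \<rightarrow>\<^sub>M prob_algebra borel"
    unfolding eq by (rule gaussian_outer_kernel[OF v c(1) cm])
  show "(\<integral>\<^sup>+v. ennreal ((norm v)\<^sup>2) \<partial>beta_d G \<pi> P v2 k x) \<le> ennreal ((gam2 G)\<^sup>2 * (norm x)\<^sup>2)" for x
    unfolding eq gaussian_outer_second_moment[OF v c(1)] by (intro ennreal_leI c(2))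
qed

subsection \<open>The dynamics under constant controls\<close>

text \<open>The power series of the integral of exp(r A) b over r from 0 to s. With \<open>b\<close>
  the initial velocity, adding it to the initial state solves y' = A y + constant without inverting
  \<open>A\<close>.\<close>

definition flow_increment :: "real^'n^'n \<Rightarrow> real^'n \<Rightarrow> real \<Rightarrow> real^'n" where
  "flow_increment A b s = (\<Sum>n. (s ^ Suc n / fact (Suc n)) *\<^sub>R (((*v) A) ^^ n) b)"

lemma norm_funpow_matrix_le: "norm ((((*v) A) ^^ n) b) \<le> norm A ^ n * norm b"
  for A :: "real^'n^'n"
proof (induction n)
  case (Suc n)
  have "norm ((((*v) A) ^^ Suc n) b) \<le> norm A * norm ((((*v) A) ^^ n) b)"
    by (simp add: norm_matrix_vector_mult_le)
  also have "\<dots> \<le> norm A * (norm A ^ n * norm b)"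
    by (intro mult_left_mono Suc.IH) simp
  finally show ?case by simp
qed simp

lemma sums_exp_real: "(\<lambda>n. x ^ n / fact n) sums exp (x :: real)"
  using exp_converges[of x] by (simp add: divide_inverse mult.commute)

text \<open>Weakening \<open>fact (Suc n)\<close> to \<open>fact n\<close> leaves the exponential
  series with one factor \<open>\<bar>s\<bar>\<close> in front. That factor makes the displacement
  proportional to the elapsed time.\<close>

lemma flow_increment_term_le:
  "norm ((s ^ Suc n / fact (Suc n)) *\<^sub>R (((*v) A) ^^ n) b) \<le> \<bar>s\<bar> * norm b * ((\<bar>s\<bar> * norm A) ^ n / fact n)"
  for A :: "real^'n^'n"
proof -
  have "norm ((s ^ Suc n / fact (Suc n)) *\<^sub>R (((*v) A) ^^ n) b)
      = \<bar>s\<bar> ^ Suc n / fact (Suc n) * norm ((((*v) A) ^^ n) b)"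
    by (simp add: power_abs abs_mult)
  also have "\<dots> \<le> \<bar>s\<bar> ^ Suc n / fact n * (norm A ^ n * norm b)"
    by (intro mult_mono norm_funpow_matrix_le divide_left_mono fact_mono) auto
  finally show ?thesis
    by (simp add: power_mult_distrib mult_ac)
qed

lemma summable_flow_increment:
  "summable (\<lambda>n. (s ^ Suc n / fact (Suc n)) *\<^sub>R (((*v) A) ^^ n) b)"
  for A :: "real^'n^'n"
  by (rule summable_comparison_test'[OF summable_mult[OF sums_summable[OF sums_exp_real]] flow_increment_term_le])

lemma norm_flow_increment_le:
  assumes "0 \<le> s"
  shows "norm (flow_increment A b s) \<le> s * exp (s * norm A) * norm b"
proof -
  have "norm (flow_increment A b s) \<le> (\<Sum>n. \<bar>s\<bar> * norm b * ((\<bar>s\<bar> * norm A) ^ n / fact n))"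
    unfolding flow_increment_def
    by (rule norm_suminf_le[OF flow_increment_term_le summable_mult[OF sums_summable[OF sums_exp_real]]])
  also have "\<dots> = \<bar>s\<bar> * norm b * exp (\<bar>s\<bar> * norm A)"
    by (rule sums_unique[OF sums_mult[OF sums_exp_real], symmetric])
  finally show ?thesis using assms by (simp add: mult_ac)
qed

text \<open>Each component is a scalar power series and may be differentiated term by term.\<close>

lemma flow_increment_has_vector_derivative:
  fixes A :: "real^'n^'n"
  shows "(flow_increment A b has_vector_derivative (b + A *v flow_increment A b s)) (at s)"
proof -
  let ?p = "\<lambda>n. (((*v) A) ^^ n) b"
  have comp: "((\<lambda>s. flow_increment A b s \<bullet> i) has_field_derivative (b + A *v flow_increment A b s) \<bullet> i) (at s)" for i
  proof -
    \<comment> \<open>The series starts with the first power of \<open>s\<close>, so the coefficient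
      of index 0 is 0. Differentiation then returns \<open>b\<close> at index 0 and, from index 1
      on, \<open>A\<close> applied to the series itself.\<close>
    define c where "c n = (case n of 0 \<Rightarrow> 0 | Suc m \<Rightarrow> (?p m \<bullet> i) / fact (Suc m))" for n
    have cs: "(\<lambda>n. c n * s ^ n) sums (flow_increment A b s \<bullet> i)" for s
    proof -
      have "(\<lambda>n. c (Suc n) * s ^ Suc n) sums (flow_increment A b s \<bullet> i)"
        using bounded_linear.sums[OF bounded_linear_inner_left[of i] summable_sums[OF summable_flow_increment[of s A b]]]
        by (simp add: c_def flow_increment_def mult_ac)
      then show ?thesis
        by (subst (asm) sums_Suc_iff) (simp add: c_def)
    qed
    have "(\<lambda>n. diffs c (Suc n) * s ^ Suc n) sums ((A *v flow_increment A b s) \<bullet> i)"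
    proof -
      have "bounded_linear (\<lambda>y. (A *v y) \<bullet> i)"
        using bounded_linear_compose[OF bounded_linear_inner_left matrix_vector_mul_bounded_linear] .
      from bounded_linear.sums[OF this summable_sums[OF summable_flow_increment[of s A b]]]
      have "(\<lambda>n. (A *v ((s ^ Suc n / fact (Suc n)) *\<^sub>R ?p n)) \<bullet> i) sums ((A *v flow_increment A b s) \<bullet> i)"
        unfolding flow_increment_def .
      moreover have "(A *v ((s ^ Suc n / fact (Suc n)) *\<^sub>R ?p n)) \<bullet> i = diffs c (Suc n) * s ^ Suc n" for n
        by (simp add: c_def diffs_def matrix_vector_mult_scaleR del: of_nat_Suc)
      ultimately show ?thesis by simp
    qed
    then have "(\<lambda>n. diffs c n * s ^ n) sums ((A *v flow_increment A b s) \<bullet> i + b \<bullet> i)"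
      by (subst (asm) sums_Suc_iff) (simp add: c_def diffs_def)
    then have "(\<Sum>n. diffs c n * s ^ n) = (b + A *v flow_increment A b s) \<bullet> i"
      by (simp add: sums_iff inner_add_left)
    moreover have "((\<lambda>s. \<Sum>n. c n * s ^ n) has_field_derivative (\<Sum>n. diffs c n * s ^ n)) (at s)"
      using cs by (intro termdiffs_strong_converges_everywhere) (auto simp: sums_iff)
    moreover have "(\<lambda>s. \<Sum>n. c n * s ^ n) = (\<lambda>s. flow_increment A b s \<bullet> i)"
      using cs by (auto simp: sums_iff)
    ultimately show ?thesis by simp
  qed
  show ?thesis
    unfolding has_vector_derivative_def
  proof (subst has_derivative_componentwise_within, intro ballI)
    fix i :: "real^'n" assume "i \<in> Basis"
    show "((\<lambda>s. flow_increment A b s \<bullet> i) has_derivative (\<lambda>h. (h *\<^sub>R (b + A *v flow_increment A b s)) \<bullet> i)) (at s)"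
      using comp[of i] by (simp add: has_field_derivative_def mult_commute_abs)
  qed
qed

text \<open>Energy argument: the squared norm changes at a rate of at most \<open>2 * norm A\<close>
  times itself, so a suitable exponential weight makes it nonincreasing as time moves away from 0.
  Both directions are treated because \<open>hold_flow\<close> is specified by an equation on the
  whole line.\<close>

lemma homogeneous_flow_zero:
  fixes z :: "real \<Rightarrow> real^'n"
  assumes z: "\<And>s. (z has_vector_derivative A *v z s) (at s)" and z0: "z 0 = 0"
  shows "z s = 0"
proof -
  let ?a = "norm A"
  have d: "((\<lambda>s. z s \<bullet> z s * exp (c * s)) has_real_derivative
      (2 * (z s \<bullet> (A *v z s)) + c * (z s \<bullet> z s)) * exp (c * s)) (at s)" for c s
  proof -
    have "((\<lambda>s. z s \<bullet> z s) has_real_derivative 2 * (z s \<bullet> (A *v z s))) (at s)"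
      using has_derivative_inner[OF z[unfolded has_vector_derivative_def] z[unfolded has_vector_derivative_def]]
      unfolding has_field_derivative_def
      by (rule has_derivative_eq_rhs) (auto simp: inner_commute)
    then show ?thesis
      by (auto intro!: derivative_eq_intros simp: algebra_simps)
  qed
  have q: "\<bar>z s \<bullet> (A *v z s)\<bar> \<le> ?a * (z s \<bullet> z s)" for s
    using quadratic_form_le[of "z s" A] by (simp add: power2_norm_eq_inner)
  have "z s \<bullet> z s \<le> 0"
  proof (cases "0 \<le> s")
    case True
    have "z s \<bullet> z s * exp (- 2 * ?a * s) \<le> z 0 \<bullet> z 0 * exp (- 2 * ?a * 0)"
    proof (rule DERIV_nonpos_imp_nonincreasing[OF True])
      fix x
      show "\<exists>y. ((\<lambda>s. z s \<bullet> z s * exp (- 2 * ?a * s)) has_real_derivative y) (at x) \<and> y \<le> 0"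
        using d[of "- 2 * ?a" x] q[of x]
        by (rule_tac exI[where x = "(2 * (z x \<bullet> (A *v z x)) + (- 2 * ?a) * (z x \<bullet> z x)) * exp ((- 2 * ?a) * x)"])
          (simp add: mult_le_0_iff abs_le_iff)
    qed
    then show ?thesis by (simp add: z0 mult_le_0_iff)
  next
    case False
    then have "s \<le> 0" by simp
    have "z s \<bullet> z s * exp (2 * ?a * s) \<le> z 0 \<bullet> z 0 * exp (2 * ?a * 0)"
    proof (rule DERIV_nonneg_imp_nondecreasing[OF \<open>s \<le> 0\<close>])
      fix x
      show "\<exists>y. ((\<lambda>s. z s \<bullet> z s * exp (2 * ?a * s)) has_real_derivative y) (at x) \<and> 0 \<le> y"
        using d[of "2 * ?a" x] q[of x]
        by (rule_tac exI[where x = "(2 * (z x \<bullet> (A *v z x)) + (2 * ?a) * (z x \<bullet> z x)) * exp ((2 * ?a) * x)"])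
          (simp add: abs_le_iff)
    qed
    then show ?thesis by (simp add: z0 mult_le_0_iff)
  qed
  then show ?thesis
    by (metis inner_gt_zero_iff not_less)
qed

definition drift :: "('n::finite, 'p::finite, 'q::finite) lq_game \<Rightarrow> real^'n \<Rightarrow> (real^'p) \<times> (real^'q) \<Rightarrow> real^'n" where
  "drift G x w = mat_A G *v x + mat_B1 G *v fst w + mat_B2 G *v snd w"

text \<open>Resolves the definite description: the series is a solution, and the difference of two
  solutions obeys the homogeneous equation with initial value 0.\<close>

lemma hold_flow_eq: "hold_flow G x w = (\<lambda>s. x + flow_increment (mat_A G) (drift G x w) s)"
  unfolding hold_flow_def
proof (rule the_equality)
  let ?A = "mat_A G" and ?b = "drift G x w"
  let ?y = "\<lambda>s. x + flow_increment ?A ?b s"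
  have y0: "?y 0 = x"
    by (simp add: flow_increment_def)
  have y: "(?y has_vector_derivative ?A *v ?y s + mat_B1 G *v fst w + mat_B2 G *v snd w) (at s)" for s
  proof -
    have "(?y has_vector_derivative 0 + (?b + ?A *v flow_increment ?A ?b s)) (at s)"
      by (intro has_vector_derivative_add has_vector_derivative_const flow_increment_has_vector_derivative)
    then show ?thesis
      by (simp add: drift_def matrix_vector_right_distrib add_ac)
  qed
  show "?y 0 = x \<and> (\<forall>s. (?y has_vector_derivative ?A *v ?y s + mat_B1 G *v fst w + mat_B2 G *v snd w) (at s))"
    using y0 y by blast
  fix z assume z: "z 0 = x \<and> (\<forall>s. (z has_vector_derivative ?A *v z s + mat_B1 G *v fst w + mat_B2 G *v snd w) (at s))"
  have "((\<lambda>s. z s - ?y s) has_vector_derivative ?A *v (z s - ?y s)) (at s)" for s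
    using has_vector_derivative_diff[OF spec[OF conjunct2[OF z]] y[of s]]
    by (simp add: matrix_vector_mult_diff_distrib)
  from homogeneous_flow_zero[OF this] y0 z have "z s - ?y s = 0" for s
    by simp
  then show "z = ?y" by auto
qed

lemma hold_flow_0 [simp]: "hold_flow G x w 0 = x"
  by (simp add: hold_flow_eq flow_increment_def)

lemma hold_flow_has_vector_derivative:
  "(hold_flow G x w has_vector_derivative drift G (hold_flow G x w s) w) (at s)"
proof -
  have "(hold_flow G x w has_vector_derivative 0 + (drift G x w + mat_A G *v flow_increment (mat_A G) (drift G x w) s)) (at s)"
    unfolding hold_flow_eq
    by (intro has_vector_derivative_add has_vector_derivative_const flow_increment_has_vector_derivative)
  then show ?thesis
    by (simp add: hold_flow_eq[of G x w] drift_def[of G "x + _"] drift_def[of G x] matrix_vector_right_distrib add_ac)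
qed

lemma continuous_on_hold_flow: "continuous_on S (hold_flow G x w)"
  by (meson continuous_at_imp_continuous_on has_vector_derivative_continuous hold_flow_has_vector_derivative)

lemma norm_drift_le:
  "norm (drift G x w) \<le> (norm (mat_A G) + norm (mat_B1 G) + norm (mat_B2 G)) * (norm x + norm (fst w) + norm (snd w))"
proof -
  have "norm (drift G x w) \<le> norm (mat_A G) * norm x + norm (mat_B1 G) * norm (fst w) + norm (mat_B2 G) * norm (snd w)"
    unfolding drift_def by (intro norm_triangle_le add_mono norm_matrix_vector_mult_le)
  also have "\<dots> \<le> (norm (mat_A G) + norm (mat_B1 G) + norm (mat_B2 G)) * (norm x + norm (fst w) + norm (snd w))"
    by (simp add: algebra_simps)
  finally show ?thesis .
qed

lemma hold_flow_dist_le: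
  assumes "0 \<le> s" "s \<le> \<tau>"
  shows "norm (hold_flow G x w s - x) \<le> s * (exp (\<tau> * norm (mat_A G)) *
    (norm (mat_A G) + norm (mat_B1 G) + norm (mat_B2 G))) * (norm x + norm (fst w) + norm (snd w))"
proof -
  have "norm (hold_flow G x w s - x) \<le> s * exp (s * norm (mat_A G)) * norm (drift G x w)"
    using norm_flow_increment_le[OF assms(1)] by (simp add: hold_flow_eq)
  also have "\<dots> \<le> s * exp (\<tau> * norm (mat_A G)) *
    ((norm (mat_A G) + norm (mat_B1 G) + norm (mat_B2 G)) * (norm x + norm (fst w) + norm (snd w)))"
    using assms by (intro mult_mono norm_drift_le) (auto intro: mult_right_mono)
  finally show ?thesis by (simp add: mult_ac)
qed

lemma borel_measurable_matrix_vector [measurable (raw)]: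
  "f \<in> borel_measurable M \<Longrightarrow> (\<lambda>z. A *v (f z :: real^'n)) \<in> borel_measurable M"
  by (rule borel_measurable_continuous_on[OF linear_continuous_on[OF matrix_vector_mul_bounded_linear]])

lemma borel_measurable_control_components:
  fixes g :: "'a \<Rightarrow> (real^'p) \<times> (real^'q)"
  assumes "g \<in> M \<rightarrow>\<^sub>M borel"
  shows "(\<lambda>z. fst (g z)) \<in> borel_measurable M" "(\<lambda>z. snd (g z)) \<in> borel_measurable M"
  using assms by (simp_all add: borel_prod[symmetric])

text \<open>Every term of the series is measurable jointly in state, controls and time.
  Measurability in time is used where the running cost is integrated with the state as a
  parameter.\<close>

lemma borel_measurable_hold_flow [measurable (raw)]:
  assumes [measurable]: "f \<in> borel_measurable M" "g \<in> M \<rightarrow>\<^sub>M borel" "h \<in> borel_measurable M"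
  shows "(\<lambda>z. hold_flow G (f z) (g z) (h z)) \<in> borel_measurable M"
proof -
  note [measurable] = borel_measurable_control_components[OF assms(2)]
  have [measurable]: "(\<lambda>z. (((*v) (mat_A G)) ^^ n) (drift G (f z) (g z))) \<in> borel_measurable M" for n
    by (induction n) (simp_all add: drift_def)
  show ?thesis
    unfolding hold_flow_eq flow_increment_def by measurable
qed

subsection \<open>Decomposition of the path cost\<close>

lemma partition_of_nth:
  assumes "partition_of a b \<pi>"
  shows "\<And>i j. i < j \<Longrightarrow> j < length \<pi> \<Longrightarrow> \<pi> ! i < \<pi> ! j" "\<pi> ! 0 = a" "\<pi> ! (length \<pi> - 1) = b"
  using assms unfolding partition_of_def sorted_wrt_iff_nth_less by (auto simp: hd_conv_nth last_conv_nth)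

lemma partition_of_length:
  assumes "partition_of a b \<pi>" "a < b"
  shows "2 \<le> length \<pi>"
proof (rule ccontr)
  assume "\<not> 2 \<le> length \<pi>"
  then have "length \<pi> - 1 = 0" by simp
  then show False
    using partition_of_nth(2,3)[OF assms(1)] assms(2) by simp
qed

lemma interval_index_eq:
  assumes "partition_of a b \<pi>" "Suc k < length \<pi>" "\<pi> ! k \<le> t" "t < \<pi> ! Suc k"
  shows "interval_index \<pi> t = k"
  unfolding interval_index_def
proof (rule Max_eqI)
  show "finite {k. Suc k < length \<pi> \<and> \<pi> ! k \<le> t}"
    by (rule finite_subset[of _ "{..<length \<pi>}"]) auto
  fix j assume j: "j \<in> {k. Suc k < length \<pi> \<and> \<pi> ! k \<le> t}"
  show "j \<le> k"
  proof (rule ccontr)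
    assume "\<not> j \<le> k"
    then have "\<pi> ! Suc k \<le> \<pi> ! j"
      using partition_of_nth(1)[OF assms(1), of "Suc k" j] j by (cases "Suc k = j") auto
    then show False using j assms(4) by auto
  qed
qed (use assms in auto)

lemma interval_index_final:
  assumes "partition_of a b \<pi>" "a < b"
  shows "interval_index \<pi> b = length \<pi> - 2"
  unfolding interval_index_def
proof (rule Max_eqI)
  show "finite {k. Suc k < length \<pi> \<and> \<pi> ! k \<le> b}"
    by (rule finite_subset[of _ "{..<length \<pi>}"]) auto
qed (use partition_of_length[OF assms] partition_nth_bounds[OF assms(1), of "length \<pi> - 2"] in auto)

definition running_cost :: "('n::finite, 'p::finite, 'q::finite) lq_game \<Rightarrow> real^'n \<Rightarrow> (real^'p) \<times> (real^'q) \<Rightarrow> real" where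
  "running_cost G x w = x \<bullet> (mat_Q G *v x) + fst w \<bullet> (mat_R1 G *v fst w) - snd w \<bullet> (mat_R2 G *v snd w)"

definition stage_cost :: "('n::finite, 'p::finite, 'q::finite) lq_game \<Rightarrow> real^'n \<Rightarrow> (real^'p) \<times> (real^'q) \<Rightarrow> real \<Rightarrow> real" where
  "stage_cost G x w \<delta> = integral {0..\<delta>} (\<lambda>s. running_cost G (hold_flow G x w s) w)"

lemma continuous_on_running_cost: "continuous_on S (\<lambda>s. running_cost G (hold_flow G x w s) w)"
  unfolding running_cost_def
  by (intro continuous_intros continuous_on_hold_flow
      bounded_linear.continuous_on[OF matrix_vector_mul_bounded_linear])

lemma stage_cost_has_integral:
  "((\<lambda>s. running_cost G (hold_flow G x w s) w) has_integral stage_cost G x w \<delta>) {0..\<delta>}"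
  unfolding stage_cost_def
  by (intro integrable_integral integrable_continuous_real continuous_on_running_cost)

lemma path_cost_eq:
  assumes part: "partition_of (t_init G) (t_final G) \<pi>" and lt: "t_init G < t_final G"
  shows "path_cost G \<pi> h = (\<Sum>k<length \<pi> - 1. stage_cost G (grid_state G \<pi> h k) (h k) (\<pi> ! Suc k - \<pi> ! k))
    + grid_state G \<pi> h (length \<pi> - 1) \<bullet> (mat_QT G *v grid_state G \<pi> h (length \<pi> - 1))"
proof -
  let ?N = "length \<pi> - 1"
  define F where "F t = running_cost G (trajectory G \<pi> h t) (h (interval_index \<pi> t))" for t
  let ?S = "\<lambda>k. stage_cost G (grid_state G \<pi> h k) (h k) (\<pi> ! Suc k - \<pi> ! k)"
  have N: "2 \<le> length \<pi>"
    by (rule partition_of_length[OF part lt])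
  have stage: "(F has_integral ?S k) {\<pi> ! k..\<pi> ! Suc k}" if k: "Suc k < length \<pi>" for k
  proof -
    let ?f = "\<lambda>s. running_cost G (hold_flow G (grid_state G \<pi> h k) (h k) s) (h k)"
    have "((\<lambda>t. ?f (t - \<pi> ! k)) has_integral ?S k) {\<pi> ! k..\<pi> ! Suc k}"
      using stage_cost_has_integral[of G "grid_state G \<pi> h k" "h k" "\<pi> ! Suc k - \<pi> ! k"]
        has_integral_shift_Icc_real[of "\<lambda>t. ?f (t - \<pi> ! k)" "\<pi> ! k" "?S k" 0 "\<pi> ! Suc k - \<pi> ! k"]
      by (simp add: o_def)
    then show ?thesis
    \<comment> \<open>Except on the last interval, \<open>interval_index\<close> already names the
      next interval at the right end point; a single point does not affect the integral.\<close>
    proof (rule has_integral_spike_finite[rotated 2])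
      show "finite {\<pi> ! Suc k}" by simp
      fix t assume "t \<in> {\<pi> ! k..\<pi> ! Suc k} - {\<pi> ! Suc k}"
      then have "interval_index \<pi> t = k"
        by (intro interval_index_eq[OF part k]) auto
      then show "F t = ?f (t - \<pi> ! k)"
        by (simp add: F_def trajectory_def)
    qed
  qed
  have "(F has_integral (\<Sum>k<n. ?S k)) {\<pi> ! 0..\<pi> ! n}" if "n \<le> ?N" for n
    using that
  proof (induction n)
    case 0
    then show ?case using has_integral_refl(2)[of F "\<pi> ! 0"] by simp
  next
    case (Suc n)
    then have n: "Suc n < length \<pi>" using N by simp
    have "(F has_integral (\<Sum>k<n. ?S k) + ?S n) {\<pi> ! 0..\<pi> ! Suc n}"
    proof (rule has_integral_combine[OF _ _ _ stage[OF n]])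
      show "\<pi> ! 0 \<le> \<pi> ! n"
        using partition_nth_bounds(1)[OF part, of n] partition_of_nth(2)[OF part] n by simp
      show "\<pi> ! n \<le> \<pi> ! Suc n"
        using partition_of_nth(1)[OF part, of n "Suc n"] n by simp
    qed (use Suc in auto)
    then show ?case by simp
  qed
  from integral_unique[OF this[OF order_refl]] partition_of_nth(2,3)[OF part]
  have "integral {t_init G..t_final G} F = (\<Sum>k<?N. ?S k)"
    by simp
  \<comment> \<open>The final time is assigned to the last interval, of index
    \<open>length \<pi> - 2\<close>; flowing through its full length yields the grid state of the
    following index.\<close>
  moreover have "trajectory G \<pi> h (t_final G) = grid_state G \<pi> h ?N"
  proof -
    obtain m where m: "length \<pi> = Suc (Suc m)"
      using N by (metis add_2_eq_Suc le_Suc_ex)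
    show ?thesis
      using interval_index_final[OF part lt] partition_of_nth(3)[OF part]
      by (simp add: trajectory_def m)
  qed
  ultimately show ?thesis
    by (simp add: path_cost_def F_def[abs_def] running_cost_def Let_def)
qed

lemma borel_measurable_running_cost [measurable (raw)]:
  assumes [measurable]: "f \<in> borel_measurable M" "g \<in> M \<rightarrow>\<^sub>M borel"
  shows "(\<lambda>z. running_cost G (f z) (g z)) \<in> borel_measurable M"
proof -
  note [measurable] = borel_measurable_control_components[OF assms(2)]
  show ?thesis
    unfolding running_cost_def by measurable
qed

lemma borel_measurable_stage_cost [measurable (raw)]:
  assumes [measurable]: "f \<in> borel_measurable M" "g \<in> M \<rightarrow>\<^sub>M borel"
  shows "(\<lambda>z. stage_cost G (f z) (g z) \<delta>) \<in> borel_measurable M"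
proof -
  \<comment> \<open>The gauge integral is replaced by a Lebesgue integral, for which measurability
    in a parameter is available.\<close>
  have "stage_cost G (f z) (g z) \<delta> = (\<integral>s. indicator {0..\<delta>} s *\<^sub>R running_cost G (hold_flow G (f z) (g z) s) (g z) \<partial>lborel)" for z
    unfolding stage_cost_def
    by (subst set_borel_integral_eq_integral(2)[symmetric])
      (simp_all add: borel_integrable_atLeastAtMost' continuous_on_running_cost set_lebesgue_integral_def)
  moreover have "(\<lambda>z. \<integral>s. indicator {0..\<delta>} s *\<^sub>R running_cost G (hold_flow G (f z) (g z) s) (g z) \<partial>lborel)
    \<in> borel_measurable M"
    by measurable
  ultimately show ?thesis by simp
qed

text \<open>The common yardstick: squared displacements and stage costs are bounded by multiples of
  it, and admissibility bounds its mean by the second moment of the state.\<close>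

definition sq_size :: "'a::real_normed_vector \<Rightarrow> 'b::real_normed_vector \<times> 'c::real_normed_vector \<Rightarrow> real" where
  "sq_size x w = (norm x)\<^sup>2 + (norm (fst w))\<^sup>2 + (norm (snd w))\<^sup>2"

lemma sq_size_nonneg [simp]: "0 \<le> sq_size x w"
  by (simp add: sq_size_def)

lemma sq_sum_le_sq_size: "(norm x + norm (fst w) + norm (snd w))\<^sup>2 \<le> 3 * sq_size x w"
proof -
  have "(a + b + c)\<^sup>2 \<le> 3 * (a\<^sup>2 + b\<^sup>2 + c\<^sup>2)" for a b c :: real
    using sum_squares_ge_zero[of "a - b" "b - c"] zero_le_power2[of "a - c"]
    by (simp add: power2_eq_square algebra_simps)
  then show ?thesis unfolding sq_size_def .
qed

text \<open>Speed of the held dynamics relative to the size of state and controls. The exponential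
  runs over the entire horizon, so the constant is the same for all intervals.\<close>

definition flow_rate :: "('n::finite, 'p::finite, 'q::finite) lq_game \<Rightarrow> real" where
  "flow_rate G = exp ((t_final G - t_init G) * norm (mat_A G)) *
    (norm (mat_A G) + norm (mat_B1 G) + norm (mat_B2 G))"

lemma flow_rate_nonneg [simp]: "0 \<le> flow_rate G"
  by (simp add: flow_rate_def)

lemma hold_flow_increment_le:
  assumes "0 \<le> s" "s \<le> t_final G - t_init G"
  shows "norm (hold_flow G x w s - x) \<le> s * flow_rate G * (norm x + norm (fst w) + norm (snd w))"
  using hold_flow_dist_le[OF assms, of G x w] by (simp add: flow_rate_def)

lemma norm_hold_flow_le:
  assumes "0 \<le> s" "s \<le> t_final G - t_init G"
  shows "norm (hold_flow G x w s)
    \<le> (1 + (t_final G - t_init G) * flow_rate G) * (norm x + norm (fst w) + norm (snd w))"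
proof -
  have "norm (hold_flow G x w s) \<le> norm x + norm (hold_flow G x w s - x)"
    by (metis add_diff_cancel_left' diff_add_cancel norm_triangle_ineq add.commute)
  also have "\<dots> \<le> (norm x + norm (fst w) + norm (snd w))
      + (t_final G - t_init G) * flow_rate G * (norm x + norm (fst w) + norm (snd w))"
    using assms
    by (intro add_mono order_trans[OF hold_flow_increment_le] mult_right_mono) auto
  finally show ?thesis by (simp add: algebra_simps)
qed

text \<open>Serves the integrability of the path cost; the constant may depend on
  \<open>\<delta>\<close>.\<close>

lemma stage_cost_bound:
  fixes G :: "('n::finite, 'p::finite, 'q::finite) lq_game"
  assumes "0 \<le> \<delta>" "\<delta> \<le> t_final G - t_init G"
  shows "\<exists>C. \<forall>x w. \<bar>stage_cost G x w \<delta>\<bar> \<le> C * sq_size x w"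
proof -
  let ?H = "1 + (t_final G - t_init G) * flow_rate G"
  let ?C = "norm (mat_Q G) * ?H\<^sup>2 + norm (mat_R1 G) + norm (mat_R2 G)"
  have "\<bar>stage_cost G x w \<delta>\<bar> \<le> (?C * (norm x + norm (fst w) + norm (snd w))\<^sup>2) * \<delta>" for x w
  proof -
    let ?n = "norm x + norm (fst w) + norm (snd w)"
    have run: "\<bar>running_cost G (hold_flow G x w s) w\<bar> \<le> ?C * ?n\<^sup>2" if s: "s \<in> {0..\<delta>}" for s
    proof -
      let ?y = "hold_flow G x w s"
      have "norm ?y \<le> ?H * ?n"
        using s assms by (intro norm_hold_flow_le) auto
      then have "(norm ?y)\<^sup>2 \<le> ?H\<^sup>2 * ?n\<^sup>2"
        using power_mono[of "norm ?y" _ 2] by (simp flip: power_mult_distrib)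
      moreover have "(norm (fst w))\<^sup>2 \<le> ?n\<^sup>2" "(norm (snd w))\<^sup>2 \<le> ?n\<^sup>2"
        by (auto intro!: power_mono)
      ultimately have "norm (mat_Q G) * (norm ?y)\<^sup>2 \<le> norm (mat_Q G) * (?H\<^sup>2 * ?n\<^sup>2)"
        "norm (mat_R1 G) * (norm (fst w))\<^sup>2 \<le> norm (mat_R1 G) * ?n\<^sup>2"
        "norm (mat_R2 G) * (norm (snd w))\<^sup>2 \<le> norm (mat_R2 G) * ?n\<^sup>2"
        by (auto intro: mult_left_mono)
      then show ?thesis
        using quadratic_form_le[of ?y "mat_Q G"] quadratic_form_le[of "fst w" "mat_R1 G"]
          quadratic_form_le[of "snd w" "mat_R2 G"]
        unfolding running_cost_def by (simp add: algebra_simps)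
    qed
    show ?thesis
      using has_integral_bound[of "?C * ?n\<^sup>2" "\<lambda>s. running_cost G (hold_flow G x w s) w" "stage_cost G x w \<delta>" 0 \<delta>]
        stage_cost_has_integral[of G x w \<delta>] run assms(1)
      by (simp add: add_nonneg_nonneg)
  qed
  note bound = this
  show ?thesis
  proof (intro exI[of _ "3 * ?C * \<delta>"] allI)
    fix x :: "real^'n" and w :: "(real^'p) \<times> (real^'q)"
    have "(?C * (norm x + norm (fst w) + norm (snd w))\<^sup>2) * \<delta> \<le> (?C * (3 * sq_size x w)) * \<delta>"
      using assms(1) by (intro mult_right_mono mult_left_mono sq_sum_le_sq_size) auto
    with bound[of x w] show "\<bar>stage_cost G x w \<delta>\<bar> \<le> 3 * ?C * \<delta> * sq_size x w"
      by (simp only: mult_ac)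
  qed
qed

subsection \<open>Second moments of the sampled state\<close>

text \<open>The control of index \<open>j\<close> acts only after the state of index
  \<open>j\<close> is reached, hence \<open>j \<le> k\<close> and not \<open>j < k\<close>.\<close>

lemma grid_state_fun_upd: "j \<le> k \<Longrightarrow> grid_state G \<pi> (h(k := w)) j = grid_state G \<pi> h j"
  by (induction j) auto

lemma borel_measurable_grid_state:
  assumes "j \<le> k"
  shows "(\<lambda>h. grid_state G \<pi> h j) \<in> borel_measurable (PiM {..<k} (\<lambda>_. borel))"
  using assms
proof (induction j)
  case (Suc j)
  then have [measurable]: "(\<lambda>h. grid_state G \<pi> h j) \<in> borel_measurable (PiM {..<k} (\<lambda>_. borel))"
    and [measurable]: "(\<lambda>h. h j) \<in> PiM {..<k} (\<lambda>_. borel) \<rightarrow>\<^sub>M borel"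
    by (auto intro: measurable_component_singleton)
  show ?case by simp
qed simp

text \<open>The growth carries a factor \<open>\<delta>\<close>, so its accumulation over many short
  steps stays bounded. The cross term contributes \<open>2 * flow_rate G\<close>, the squared
  displacement the other summand after one of its two factors \<open>\<delta>\<close> is estimated
  by the horizon; the 3 stems from \<open>sq_sum_le_sq_size\<close>.\<close>

lemma norm_hold_flow_sq_le:
  assumes "0 \<le> \<delta>" "\<delta> \<le> t_final G - t_init G"
  shows "(norm (hold_flow G x w \<delta>))\<^sup>2
    \<le> (norm x)\<^sup>2 + 3 * (2 * flow_rate G + (t_final G - t_init G) * (flow_rate G)\<^sup>2) * \<delta> * sq_size x w"
proof -
  let ?\<rho> = "flow_rate G" and ?n = "norm x + norm (fst w) + norm (snd w)" and ?T = "t_final G - t_init G"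
  let ?d = "norm (hold_flow G x w \<delta> - x)"
  have d: "?d \<le> \<delta> * ?\<rho> * ?n"
    by (rule hold_flow_increment_le[OF assms])
  have "norm (hold_flow G x w \<delta>) \<le> norm x + ?d"
    by (metis add_diff_cancel_left' diff_add_cancel norm_triangle_ineq add.commute)
  then have "(norm (hold_flow G x w \<delta>))\<^sup>2 \<le> (norm x + ?d)\<^sup>2"
    by (intro power_mono) auto
  also have "\<dots> = (norm x)\<^sup>2 + 2 * (norm x * ?d) + ?d\<^sup>2"
    by (simp add: power2_sum)
  also have "\<dots> \<le> (norm x)\<^sup>2 + 2 * (?n * (\<delta> * ?\<rho> * ?n)) + (\<delta> * ?\<rho> * ?n)\<^sup>2"
    using d by (intro add_mono mult_left_mono mult_mono power_mono order_refl) auto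
  also have "\<dots> = (norm x)\<^sup>2 + (2 * ?\<rho> + \<delta> * ?\<rho>\<^sup>2) * \<delta> * ?n\<^sup>2"
    by (simp add: power2_eq_square algebra_simps)
  also have "\<dots> \<le> (norm x)\<^sup>2 + (2 * ?\<rho> + ?T * ?\<rho>\<^sup>2) * \<delta> * (3 * sq_size x w)"
    using assms
    by (intro add_left_mono mult_mono sq_sum_le_sq_size mult_right_mono) (auto intro!: mult_nonneg_nonneg)
  finally show ?thesis by (simp only: mult_ac)
qed

lemma nn_integral_pair_fst:
  assumes "prob_space M" "prob_space N" "f \<in> borel_measurable M"
  shows "(\<integral>\<^sup>+w. f (fst w) \<partial>(M \<Otimes>\<^sub>M N)) = (\<integral>\<^sup>+u. f u \<partial>M)"
proof -
  interpret N: prob_space N by fact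
  show ?thesis
    using assms(3) by (subst N.nn_integral_fst[symmetric]) (simp_all add: N.emeasure_space_1)
qed

lemma nn_integral_pair_snd:
  assumes "prob_space M" "prob_space N" "f \<in> borel_measurable N"
  shows "(\<integral>\<^sup>+w. f (snd w) \<partial>(M \<Otimes>\<^sub>M N)) = (\<integral>\<^sup>+v. f v \<partial>N)"
proof -
  interpret N: prob_space N by fact
  interpret M: prob_space M by fact
  show ?thesis
    using assms(3) by (subst N.nn_integral_fst[symmetric]) (simp_all add: M.emeasure_space_1)
qed

section \<open>The law of the control histories and its second moments\<close>

locale strategy_pair =
  fixes G :: "('n::finite, 'p::finite, 'q::finite) lq_game" and \<pi> :: "real list"
    and \<mu> :: "nat \<Rightarrow> real^'n \<Rightarrow> (real^'p) measure" and \<nu> :: "nat \<Rightarrow> real^'n \<Rightarrow> (real^'q) measure"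
  assumes time: "t_init G < t_final G"
    and part: "partition_of (t_init G) (t_final G) \<pi>"
    and mu: "\<mu> \<in> mixed_strategies (gam1 G) \<pi>"
    and nu: "\<nu> \<in> mixed_strategies (gam2 G) \<pi>"
begin

definition law where "law = control_law G \<pi> \<mu> \<nu>"

definition hist :: "nat \<Rightarrow> (nat \<Rightarrow> (real^'p) \<times> (real^'q)) measure" where
  "hist k = PiM {..<k} (\<lambda>_. borel)"

abbreviation "X h k \<equiv> grid_state G \<pi> h k"

abbreviation "step k \<equiv> \<pi> ! Suc k - \<pi> ! k"

definition kern where
  "kern k h = distr (\<mu> k (X h k) \<Otimes>\<^sub>M \<nu> k (X h k)) (hist (Suc k)) (\<lambda>w. h(k := w))"

lemma law_Suc: "law (Suc k) = law k \<bind> kern k"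
  by (simp add: law_def kern_def[abs_def] hist_def)

lemma step_bounds:
  assumes "Suc k < length \<pi>"
  shows "0 < step k" "step k \<le> t_final G - t_init G"
  using partition_of_nth(1)[OF part, of k "Suc k"] partition_nth_bounds[OF part, of k]
    partition_nth_bounds[OF part, of "Suc k"] assms by auto

lemma measurable_X [measurable]: "j \<le> k \<Longrightarrow> (\<lambda>h. X h j) \<in> borel_measurable (hist k)"
  unfolding hist_def by (rule borel_measurable_grid_state)

lemma measurable_control [measurable]: "j < k \<Longrightarrow> (\<lambda>h. h j) \<in> hist k \<rightarrow>\<^sub>M borel"
  unfolding hist_def by (rule measurable_component_singleton) simp

lemma measurable_upd: "(\<lambda>(h, w). h(k := w)) \<in> hist k \<Otimes>\<^sub>M (borel \<Otimes>\<^sub>M borel) \<rightarrow>\<^sub>M hist (Suc k)"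
  unfolding hist_def borel_prod split_beta'
  by (rule measurable_fun_upd[where J = "{..<k}"]) (auto simp: lessThan_Suc)

lemma kernels [measurable]:
  assumes "Suc k < length \<pi>"
  shows "\<mu> k \<in> borel \<rightarrow>\<^sub>M prob_algebra borel" "\<nu> k \<in> borel \<rightarrow>\<^sub>M prob_algebra borel"
  using mu nu assms unfolding mixed_strategies_def by auto

lemma kernel_props:
  assumes "Suc k < length \<pi>"
  shows "prob_space (\<mu> k x)" "prob_space (\<nu> k x)" "sets (\<mu> k x) = sets borel" "sets (\<nu> k x) = sets borel"
  using kernels[OF assms, THEN measurable_space, of x] by (auto simp: space_prob_algebra)

lemma measurable_kern [measurable]:
  assumes [simp]: "Suc k < length \<pi>"
  shows "kern k \<in> hist k \<rightarrow>\<^sub>M prob_algebra (hist (Suc k))"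
proof -
  have [measurable]: "(\<lambda>h. X h k) \<in> borel_measurable (hist k)"
    by (rule measurable_X) simp
  note [measurable] = kernels[OF assms]
  show ?thesis
    unfolding kern_def[abs_def]
    by (rule measurable_distr_prob_space2[where M = "borel \<Otimes>\<^sub>M borel"])
      (use measurable_upd in \<open>measurable, auto\<close>)
qed

lemma law_prob_algebra: "k \<le> length \<pi> - 1 \<Longrightarrow> law k \<in> space (prob_algebra (hist k))"
proof (induction k)
  case 0
  then show ?case
    by (auto simp: law_def hist_def space_prob_algebra space_PiM intro!: prob_space_return)
next
  case (Suc k)
  then have "law k \<in> space (prob_algebra (hist k))" "Suc k < length \<pi>"
    by auto
  then show ?case
    unfolding law_Suc
    \<comment> \<open>The bind rule concerns measurable families of measures; a constant family over
      an arbitrary discrete space turns it into a statement about the single measure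
      \<open>law k\<close>.\<close>
    using measurable_bind_prob_space[OF measurable_const measurable_kern, THEN measurable_space, of "law k" k undefined "count_space UNIV"]
    by simp
qed

lemma law_props:
  assumes "k \<le> length \<pi> - 1"
  shows "prob_space (law k)" "sets (law k) = sets (hist k)"
  using law_prob_algebra[OF assms] by (auto simp: space_prob_algebra)

text \<open>Tower property: the last pair of controls is integrated first, given the
  history.\<close>

lemma nn_integral_law_Suc:
  assumes k: "Suc k < length \<pi>" and f: "f \<in> borel_measurable (hist (Suc k))"
  shows "(\<integral>\<^sup>+h. f h \<partial>law (Suc k)) = (\<integral>\<^sup>+h. (\<integral>\<^sup>+w. f (h(k := w)) \<partial>(\<mu> k (X h k) \<Otimes>\<^sub>M \<nu> k (X h k))) \<partial>law k)"
proof -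
  have sets: "sets (law k) = sets (hist k)"
    using k by (intro law_props) simp
  have "(\<integral>\<^sup>+h. f h \<partial>law (Suc k)) = (\<integral>\<^sup>+h. (\<integral>\<^sup>+h'. f h' \<partial>kern k h) \<partial>law k)"
    unfolding law_Suc
    by (rule nn_integral_bind[OF f]) (use measurable_prob_algebraD[OF measurable_kern[OF k]] sets in \<open>simp cong: measurable_cong_sets\<close>)
  also have "\<dots> = (\<integral>\<^sup>+h. (\<integral>\<^sup>+w. f (h(k := w)) \<partial>(\<mu> k (X h k) \<Otimes>\<^sub>M \<nu> k (X h k))) \<partial>law k)"
  proof (rule nn_integral_cong)
    fix h assume "h \<in> space (law k)"
    then have h: "h \<in> space (hist k)"
      using sets_eq_imp_space_eq[OF sets] by simp
    have "sets (\<mu> k (X h k) \<Otimes>\<^sub>M \<nu> k (X h k)) = sets (borel \<Otimes>\<^sub>M borel)"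
      using kernel_props[OF k] by (intro sets_pair_measure_cong) auto
    moreover have "(\<lambda>w. h(k := w)) \<in> borel \<Otimes>\<^sub>M borel \<rightarrow>\<^sub>M hist (Suc k)"
      using measurable_compose[OF measurable_Pair1'[OF h] measurable_upd] by simp
    ultimately have "(\<lambda>w. h(k := w)) \<in> \<mu> k (X h k) \<Otimes>\<^sub>M \<nu> k (X h k) \<rightarrow>\<^sub>M hist (Suc k)"
      by (simp cong: measurable_cong_sets)
    then show "(\<integral>\<^sup>+h'. f h' \<partial>kern k h) = (\<integral>\<^sup>+w. f (h(k := w)) \<partial>(\<mu> k (X h k) \<Otimes>\<^sub>M \<nu> k (X h k)))"
      unfolding kern_def using f by (subst nn_integral_distr) auto
  qed
  finally show ?thesis .
qed

lemma prob_space_pair_kernel: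
  assumes "Suc k < length \<pi>"
  shows "prob_space (\<mu> k x \<Otimes>\<^sub>M \<nu> k x)"
  using kernel_props[OF assms] by (intro prob_space_pair)

text \<open>Controls drawn later have total mass 1 and integrate out. Functionals of an early
  history can thus be evaluated under the law of the complete history, and all expectations below
  refer to that one law.\<close>

lemma nn_integral_law_extend:
  assumes "k \<le> n" "n \<le> length \<pi> - 1"
    and "\<And>m. k \<le> m \<Longrightarrow> f \<in> borel_measurable (hist m)"
    and "\<And>m h w. k \<le> m \<Longrightarrow> f (h(m := w)) = f h"
  shows "(\<integral>\<^sup>+h. f h \<partial>law n) = (\<integral>\<^sup>+h. f h \<partial>law k)"
  using assms(1,2)
proof (induction n rule: dec_induct)
  case (step n)
  then have n: "Suc n < length \<pi>" by simp
  have "(\<integral>\<^sup>+h. f h \<partial>law (Suc n)) = (\<integral>\<^sup>+h. f h \<partial>law n)"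
    unfolding nn_integral_law_Suc[OF n assms(3)[OF le_SucI[OF step.hyps(1)]]]
    using step.hyps(1) prob_space.emeasure_space_1[OF prob_space_pair_kernel[OF n]]
    by (simp add: assms(4))
  then show ?case using step by simp
qed simp

lemma nn_integral_law_control:
  assumes k: "Suc k < length \<pi>" and g [measurable]: "case_prod g \<in> borel_measurable (borel \<Otimes>\<^sub>M borel)"
  shows "(\<integral>\<^sup>+h. g (X h k) (h k) \<partial>law (length \<pi> - 1))
    = (\<integral>\<^sup>+h. (\<integral>\<^sup>+w. g (X h k) w \<partial>(\<mu> k (X h k) \<Otimes>\<^sub>M \<nu> k (X h k))) \<partial>law k)"
proof -
  have meas: "(\<lambda>h. g (X h k) (h k)) \<in> borel_measurable (hist m)" if "Suc k \<le> m" for m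
  proof -
    have [measurable]: "(\<lambda>h. X h k) \<in> borel_measurable (hist m)" "(\<lambda>h. h k) \<in> hist m \<rightarrow>\<^sub>M borel"
      using that by auto
    show ?thesis by measurable
  qed
  have "(\<integral>\<^sup>+h. g (X h k) (h k) \<partial>law (length \<pi> - 1)) = (\<integral>\<^sup>+h. g (X h k) (h k) \<partial>law (Suc k))"
    by (rule nn_integral_law_extend) (use k meas in \<open>auto simp: grid_state_fun_upd\<close>)
  then show ?thesis
    using nn_integral_law_Suc[OF k meas[OF order_refl]] by (simp add: grid_state_fun_upd)
qed

lemma nn_integral_law_state:
  assumes "k \<le> length \<pi> - 1" and [measurable]: "g \<in> borel_measurable borel"
  shows "(\<integral>\<^sup>+h. g (X h k) \<partial>law (length \<pi> - 1)) = (\<integral>\<^sup>+h. g (X h k) \<partial>law k)"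
proof (rule nn_integral_law_extend)
  show "(\<lambda>h. g (X h k)) \<in> borel_measurable (hist m)" if "k \<le> m" for m
    using measurable_compose[OF measurable_X[OF that] assms(2)] .
qed (use assms in \<open>auto simp: grid_state_fun_upd\<close>)

lemma borel_measurable_kernel:
  assumes "Suc k < length \<pi>"
  shows "f \<in> borel_measurable borel \<Longrightarrow> f \<in> borel_measurable (\<mu> k x)"
    and "g \<in> borel_measurable borel \<Longrightarrow> g \<in> borel_measurable (\<nu> k x)"
  using kernel_props[OF assms] by (simp_all cong: measurable_cong_sets)

abbreviation "moment k \<equiv> \<integral>\<^sup>+h. ennreal ((norm (X h k))\<^sup>2) \<partial>law (length \<pi> - 1)"

text \<open>Bounds the conditional mean of \<open>sq_size\<close> given the state, relative to the
  squared norm of the state: 1 for the state itself and the admissible budget for each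
  player.\<close>

definition gain_rate where "gain_rate = 1 + (gam1 G)\<^sup>2 + (gam2 G)\<^sup>2"

lemma sq_size_moment_le:
  assumes k: "Suc k < length \<pi>"
  shows "(\<integral>\<^sup>+h. ennreal (sq_size (X h k) (h k)) \<partial>law (length \<pi> - 1)) \<le> ennreal gain_rate * moment k"
proof -
  have g: "(\<lambda>(x :: real^'n, w :: (real^'p) \<times> (real^'q)). ennreal (sq_size x w)) \<in> borel_measurable (borel \<Otimes>\<^sub>M borel)"
    unfolding sq_size_def borel_prod[symmetric] by measurable
  have inner: "(\<integral>\<^sup>+w. ennreal (sq_size x w) \<partial>(\<mu> k x \<Otimes>\<^sub>M \<nu> k x)) \<le> ennreal (gain_rate * (norm x)\<^sup>2)" for x
  proof -
    note p = kernel_props(1,2)[OF k, of x]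
    interpret prob_space "\<mu> k x \<Otimes>\<^sub>M \<nu> k x"
      by (rule prob_space_pair_kernel[OF k])
    have m1: "(\<lambda>u. ennreal ((norm u)\<^sup>2)) \<in> borel_measurable (\<mu> k x)"
      and m2: "(\<lambda>v. ennreal ((norm v)\<^sup>2)) \<in> borel_measurable (\<nu> k x)"
      by (auto intro!: borel_measurable_kernel[OF k])
    have "(\<integral>\<^sup>+w. ennreal (sq_size x w) \<partial>(\<mu> k x \<Otimes>\<^sub>M \<nu> k x))
      = (\<integral>\<^sup>+w. ennreal ((norm x)\<^sup>2) + ennreal ((norm (fst w))\<^sup>2) + ennreal ((norm (snd w))\<^sup>2) \<partial>(\<mu> k x \<Otimes>\<^sub>M \<nu> k x))"
      by (simp add: sq_size_def)
    also have "\<dots> = ennreal ((norm x)\<^sup>2) + (\<integral>\<^sup>+u. ennreal ((norm u)\<^sup>2) \<partial>\<mu> k x) + (\<integral>\<^sup>+v. ennreal ((norm v)\<^sup>2) \<partial>\<nu> k x)"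
      using measurable_compose[OF measurable_fst m1, of "\<nu> k x"] measurable_compose[OF measurable_snd m2, of "\<mu> k x"]
      apply (subst nn_integral_add)
        apply (simp_all add: nn_integral_pair_snd[OF p m2] del: borel_measurable_ennreal_iff)
      by (subst nn_integral_add) (simp_all add: emeasure_space_1 nn_integral_pair_fst[OF p m1])
    also have "\<dots> \<le> ennreal ((norm x)\<^sup>2) + ennreal ((gam1 G)\<^sup>2 * (norm x)\<^sup>2) + ennreal ((gam2 G)\<^sup>2 * (norm x)\<^sup>2)"
      using mu nu k unfolding mixed_strategies_def by (intro add_mono order_refl) auto
    also have "\<dots> = ennreal (gain_rate * (norm x)\<^sup>2)"
      by (simp add: gain_rate_def algebra_simps)
    finally show ?thesis .
  qed
  have "(\<integral>\<^sup>+h. ennreal (sq_size (X h k) (h k)) \<partial>law (length \<pi> - 1))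
      \<le> (\<integral>\<^sup>+h. ennreal (gain_rate * (norm (X h k))\<^sup>2) \<partial>law k)"
    unfolding nn_integral_law_control[OF k g] by (intro nn_integral_mono inner)
  also have "\<dots> = (\<integral>\<^sup>+h. ennreal (gain_rate * (norm (X h k))\<^sup>2) \<partial>law (length \<pi> - 1))"
    using k by (intro nn_integral_law_state[symmetric]) auto
  also have "\<dots> = ennreal gain_rate * moment k"
  proof -
    have "(\<lambda>h. X h k) \<in> borel_measurable (law (length \<pi> - 1))"
      using measurable_X[of k "length \<pi> - 1"] k law_props(2)[OF order_refl] by (simp cong: measurable_cong_sets)
    then show ?thesis
      by (subst nn_integral_cmult[symmetric]) (auto simp: gain_rate_def ennreal_mult)
  qed
  finally show ?thesis .
qed

text \<open>Exponential rate of the second moments: the one-step coefficient of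
  \<open>norm_hold_flow_sq_le\<close> times the conditional bound.\<close>

definition growth where
  "growth = 3 * (2 * flow_rate G + (t_final G - t_init G) * (flow_rate G)\<^sup>2) * gain_rate"

lemma gain_rate_nonneg [simp]: "0 \<le> gain_rate"
  by (simp add: gain_rate_def)

lemma growth_nonneg [simp]: "0 \<le> growth"
  using time by (simp add: growth_def)

lemma measurable_law [measurable]:
  "k \<le> length \<pi> - 1 \<Longrightarrow> (\<lambda>h. X h k) \<in> borel_measurable (law (length \<pi> - 1))"
  "k < length \<pi> - 1 \<Longrightarrow> (\<lambda>h. h k) \<in> law (length \<pi> - 1) \<rightarrow>\<^sub>M borel"
  "k < length \<pi> - 1 \<Longrightarrow> (\<lambda>h. fst (h k)) \<in> borel_measurable (law (length \<pi> - 1))"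
  "k < length \<pi> - 1 \<Longrightarrow> (\<lambda>h. snd (h k)) \<in> borel_measurable (law (length \<pi> - 1))"
proof -
  show "k \<le> length \<pi> - 1 \<Longrightarrow> (\<lambda>h. X h k) \<in> borel_measurable (law (length \<pi> - 1))"
    and *: "k < length \<pi> - 1 \<Longrightarrow> (\<lambda>h. h k) \<in> law (length \<pi> - 1) \<rightarrow>\<^sub>M borel"
    using measurable_X[of k "length \<pi> - 1"] measurable_control[of k "length \<pi> - 1"] law_props(2)[OF order_refl]
    by (simp_all cong: measurable_cong_sets)
  show "k < length \<pi> - 1 \<Longrightarrow> (\<lambda>h. fst (h k)) \<in> borel_measurable (law (length \<pi> - 1))"
    "k < length \<pi> - 1 \<Longrightarrow> (\<lambda>h. snd (h k)) \<in> borel_measurable (law (length \<pi> - 1))"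
    using * by (auto intro: borel_measurable_control_components)
qed

text \<open>Discrete Gronwall argument: one interval multiplies the moment by at most
  \<open>1 + growth * step k\<close>, hence by at most \<open>exp (growth * step k)\<close>, and the
  exponents add up to elapsed time, so the number of intervals does not enter. Nonnegative integrals
  spare the induction any integrability assumption.\<close>

lemma moment_le:
  "k \<le> length \<pi> - 1 \<Longrightarrow> moment k \<le> ennreal (exp (growth * (\<pi> ! k - t_init G)) * (norm (x_init G))\<^sup>2)"
proof (induction k)
  case 0
  then show ?case
    using partition_of_nth(2)[OF part] prob_space.emeasure_space_1[OF law_props(1)[OF order_refl]]
    by simp
next
  case (Suc k)
  then have k: "Suc k < length \<pi>" by simp
  let ?L = "law (length \<pi> - 1)"
  let ?c = "3 * (2 * flow_rate G + (t_final G - t_init G) * (flow_rate G)\<^sup>2)"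
  have c: "0 \<le> ?c" using time by simp
  note st = step_bounds[OF k]
  have k': "k < length \<pi> - 1" "k \<le> length \<pi> - 1" using k by auto
  note [measurable] = measurable_law(1)[OF k'(2)] measurable_law(2-4)[OF k'(1)]
  have m1: "(\<lambda>h. ennreal ((norm (X h k))\<^sup>2)) \<in> borel_measurable ?L"
    by measurable
  have m2: "(\<lambda>h. ennreal (sq_size (X h k) (h k))) \<in> borel_measurable ?L"
    unfolding sq_size_def by measurable
  have "moment (Suc k) \<le> (\<integral>\<^sup>+h. ennreal ((norm (X h k))\<^sup>2) + ennreal (?c * step k) * ennreal (sq_size (X h k) (h k)) \<partial>?L)"
  proof (intro nn_integral_mono)
    fix h
    have "(norm (X h (Suc k)))\<^sup>2 \<le> (norm (X h k))\<^sup>2 + (?c * step k) * sq_size (X h k) (h k)"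
      using norm_hold_flow_sq_le[of "step k" G "X h k" "h k"] st by simp
    then show "ennreal ((norm (X h (Suc k)))\<^sup>2) \<le> ennreal ((norm (X h k))\<^sup>2) + ennreal (?c * step k) * ennreal (sq_size (X h k) (h k))"
      using c st by (subst ennreal_mult[symmetric]) (auto simp flip: ennreal_plus intro: ennreal_leI)
  qed
  also have "\<dots> = moment k + ennreal (?c * step k) * (\<integral>\<^sup>+h. ennreal (sq_size (X h k) (h k)) \<partial>?L)"
    by (subst nn_integral_cmult[OF m2, symmetric], rule nn_integral_add[OF m1]) (use m2 in measurable)
  also have "\<dots> \<le> moment k + ennreal (?c * step k) * (ennreal gain_rate * moment k)"
    by (intro add_left_mono mult_left_mono sq_size_moment_le k) simp
  also have "\<dots> = ennreal (1 + growth * step k) * moment k"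
  proof -
    have "ennreal (1 + growth * step k) = 1 + ennreal (?c * step k) * ennreal gain_rate"
      using c st by (simp add: growth_def ennreal_mult[symmetric] mult_ac)
    then show ?thesis by (simp add: distrib_right mult.assoc)
  qed
  also have "\<dots> \<le> ennreal (exp (growth * step k)) * ennreal (exp (growth * (\<pi> ! k - t_init G)) * (norm (x_init G))\<^sup>2)"
    using Suc k by (intro mult_mono ennreal_leI exp_ge_add_one_self) auto
  also have "\<dots> = ennreal (exp (growth * (\<pi> ! Suc k - t_init G)) * (norm (x_init G))\<^sup>2)"
    by (subst ennreal_mult[symmetric]) (auto simp: mult.assoc[symmetric] exp_add[symmetric] right_diff_distrib)
  finally show ?case .
qed

text \<open>A function of \<open>G\<close> only: one constant serves all partitions and all
  deviating strategies. Outside the locale it reads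
  \<open>strategy_pair.moment_const G\<close>.\<close>

definition moment_const where
  "moment_const = gain_rate * (exp (growth * (t_final G - t_init G)) * (norm (x_init G))\<^sup>2)"

lemma moment_const_nonneg [simp]: "0 \<le> moment_const"
  by (simp add: moment_const_def)

lemma exp_growth_le:
  assumes "k < length \<pi>"
  shows "exp (growth * (\<pi> ! k - t_init G)) \<le> exp (growth * (t_final G - t_init G))"
  using partition_nth_bounds[OF part assms] by (auto intro!: mult_left_mono)

lemma sq_size_integral:
  assumes k: "Suc k < length \<pi>"
  shows "integrable (law (length \<pi> - 1)) (\<lambda>h. sq_size (X h k) (h k))"
    and "(\<integral>h. sq_size (X h k) (h k) \<partial>law (length \<pi> - 1)) \<le> moment_const"
proof -
  have k': "k < length \<pi> - 1" "k \<le> length \<pi> - 1" using k by auto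
  note [measurable] = measurable_law(1)[OF k'(2)] measurable_law(2-4)[OF k'(1)]
  have m: "(\<lambda>h. sq_size (X h k) (h k)) \<in> borel_measurable (law (length \<pi> - 1))"
    unfolding sq_size_def by measurable
  have "(\<integral>\<^sup>+h. ennreal (sq_size (X h k) (h k)) \<partial>law (length \<pi> - 1))
      \<le> ennreal gain_rate * ennreal (exp (growth * (\<pi> ! k - t_init G)) * (norm (x_init G))\<^sup>2)"
    by (rule order_trans[OF sq_size_moment_le[OF k]]) (use k in \<open>intro mult_left_mono moment_le, auto\<close>)
  also have "\<dots> \<le> ennreal moment_const"
    unfolding moment_const_def using exp_growth_le[of k] k
    by (subst ennreal_mult[symmetric]) (auto intro!: ennreal_leI mult_left_mono mult_right_mono)
  finally have le: "(\<integral>\<^sup>+h. ennreal (sq_size (X h k) (h k)) \<partial>law (length \<pi> - 1)) \<le> ennreal moment_const" .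
  show int: "integrable (law (length \<pi> - 1)) (\<lambda>h. sq_size (X h k) (h k))"
    by (rule integrableI_nonneg[OF m]) (use le in \<open>auto intro: le_less_trans\<close>)
  show "(\<integral>h. sq_size (X h k) (h k) \<partial>law (length \<pi> - 1)) \<le> moment_const"
    using le unfolding nn_integral_eq_integral[OF int AE_I2[OF sq_size_nonneg]] by simp
qed

lemma integrable_path_cost: "integrable (law (length \<pi> - 1)) (path_cost G \<pi>)"
proof -
  let ?N = "length \<pi> - 1"
  have stage: "integrable (law ?N) (\<lambda>h. stage_cost G (X h k) (h k) (step k))" if k: "k < ?N" for k
  proof -
    have k': "Suc k < length \<pi>" "k \<le> ?N" using k by auto
    note [measurable] = measurable_law(1)[OF k'(2)] measurable_law(2)[OF k]
    obtain C where C: "\<And>x w. \<bar>stage_cost G x w (step k)\<bar> \<le> C * sq_size x w"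
      using stage_cost_bound[of "step k" G] step_bounds[OF k'(1)] by auto
    show ?thesis
    proof (rule Bochner_Integration.integrable_bound)
      show "integrable (law ?N) (\<lambda>h. C * sq_size (X h k) (h k))"
        using sq_size_integral(1)[OF k'(1)] by simp
      show "AE h in law ?N. norm (stage_cost G (X h k) (h k) (step k)) \<le> norm (C * sq_size (X h k) (h k))"
        using C by (auto intro!: AE_I2 order_trans[OF C] abs_ge_self)
    qed measurable
  qed
  have terminal: "integrable (law ?N) (\<lambda>h. X h ?N \<bullet> (mat_QT G *v X h ?N))"
  proof (rule Bochner_Integration.integrable_bound)
    note [measurable] = measurable_law(1)[OF order_refl]
    have "(\<lambda>h. (norm (X h ?N))\<^sup>2) \<in> borel_measurable (law ?N)"
      by measurable
    moreover have "moment ?N < \<infinity>"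
      using moment_le[OF order_refl] by (rule le_less_trans) simp
    ultimately show "integrable (law ?N) (\<lambda>h. norm (mat_QT G) * (norm (X h ?N))\<^sup>2)"
      by (intro integrable_mult_right integrableI_nonneg AE_I2 zero_le_power2)
    show "(\<lambda>h. X h ?N \<bullet> (mat_QT G *v X h ?N)) \<in> borel_measurable (law ?N)"
      by measurable
    show "AE h in law ?N. norm (X h ?N \<bullet> (mat_QT G *v X h ?N)) \<le> norm (norm (mat_QT G) * (norm (X h ?N))\<^sup>2)"
      by (auto intro!: AE_I2 quadratic_form_le)
  qed
  show ?thesis
    unfolding path_cost_eq[OF part time, abs_def] using stage terminal
    by (intro Bochner_Integration.integrable_add Bochner_Integration.integrable_sum) auto
qed

lemma expected_cost_eq: "expected_cost G \<pi> \<mu> \<nu> = (\<integral>h. path_cost G \<pi> h \<partial>law (length \<pi> - 1))"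
  by (simp add: expected_cost_def law_def)

end

subsection \<open>The Riccati equation\<close>

lemma interval_index_props:
  assumes part: "partition_of a b \<pi>" and "a < b" "t \<in> {a..b}"
  shows "Suc (interval_index \<pi> t) < length \<pi>" "\<pi> ! interval_index \<pi> t \<le> t" "t \<le> \<pi> ! Suc (interval_index \<pi> t)"
proof -
  let ?S = "{k. Suc k < length \<pi> \<and> \<pi> ! k \<le> t}" and ?i = "interval_index \<pi> t"
  have fin: "finite ?S"
    by (rule finite_subset[of _ "{..<length \<pi>}"]) auto
  have "0 \<in> ?S"
    using partition_of_length[OF part assms(2)] partition_of_nth(2)[OF part] assms(3) by auto
  then have "?i \<in> ?S"
    unfolding interval_index_def by (intro Max_in fin) auto
  then show i: "Suc ?i < length \<pi>" "\<pi> ! ?i \<le> t" by auto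
  show "t \<le> \<pi> ! Suc ?i"
  proof (cases "Suc (Suc ?i) < length \<pi>")
    case True
    then show ?thesis
      using Max_ge[OF fin, of "Suc ?i"] unfolding interval_index_def[symmetric] by force
  next
    case False
    then have "Suc ?i = length \<pi> - 1" using i by simp
    then show ?thesis using partition_of_nth(3)[OF part] assms(3) by simp
  qed
qed

lemma step_le_mesh:
  assumes "Suc k < length \<pi>"
  shows "\<pi> ! Suc k - \<pi> ! k \<le> mesh \<pi>"
  unfolding mesh_def
proof (rule Max_ge)
  have "{\<pi> ! Suc k - \<pi> ! k |k. Suc k < length \<pi>} \<subseteq> (\<lambda>k. \<pi> ! Suc k - \<pi> ! k) ` {..<length \<pi>}"
    by auto
  then show "finite {\<pi> ! Suc k - \<pi> ! k |k. Suc k < length \<pi>}"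
    by (rule finite_subset) simp
qed (use assms in auto)

definition riccati_offset :: "('n::finite, 'p::finite, 'q::finite) lq_game \<Rightarrow> real" where
  "riccati_offset G = norm (mat_Q G)"

text \<open>Coefficient of \<open>norm (P t)\<close> in the growth bound of
  \<open>norm_P'_le\<close>. Its summands belong to the linear terms, to the two gain terms with
  gains estimated by \<open>norm_matrix_le_of_operator_bound\<close>, and to \<open>lam2\<close>
  with the horizon in place of the step.\<close>

definition riccati_slope :: "('n::finite, 'p::finite, 'q::finite) lq_game \<Rightarrow> real" where
  "riccati_slope G = 2 * norm (mat_A G) + norm (mat_B1 G) * (real CARD('n) * gam1 G)
     + norm (mat_B2 G) * (real CARD('n) * gam2 G)
     + real CARD('n) * ((t_final G - t_init G) * (norm (mat_B2 G))\<^sup>2 * (gam2 G)\<^sup>2)"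

text \<open>Outcome of a Gronwall estimate, started at the terminal matrix, for the squared norm of
  \<open>P\<close> plus the squared offset; the added square absorbs the constant term of the growth
  bound.\<close>

definition riccati_bound :: "('n::finite, 'p::finite, 'q::finite) lq_game \<Rightarrow> real" where
  "riccati_bound G = sqrt (((norm (mat_QT G))\<^sup>2 + (riccati_offset G)\<^sup>2)
     * exp ((1 + 2 * riccati_slope G) * (t_final G - t_init G)))"

definition riccati_speed :: "('n::finite, 'p::finite, 'q::finite) lq_game \<Rightarrow> real" where
  "riccati_speed G = riccati_offset G + riccati_slope G * riccati_bound G"

locale riccati_game =
  fixes G :: "('n::finite, 'p::finite, 'q::finite) lq_game" and \<pi> :: "real list"
    and P :: "real \<Rightarrow> real^'n^'n" and v2 :: "real \<Rightarrow> real^'q"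
  assumes data: "lq_game_data G"
    and part: "partition_of (t_init G) (t_final G) \<pi>"
    and ric: "riccati_solution G \<pi> P"
    and cap: "capacity_conditions G \<pi> P"
    and top: "top_eigenvector G \<pi> P v2"
begin

abbreviation "step k \<equiv> \<pi> ! Suc k - \<pi> ! k"

lemma time: "t_init G < t_final G" and gam: "0 < gam1 G" "0 < gam2 G"
  using data by (auto simp: lq_game_data_def)

lemma R1_pos_def: "pos_def (mat_R1 G)" and R2_pos_def: "pos_def (mat_R2 G)"
  using data by (auto simp: lq_game_data_def)

lemma P_symmetric: "t \<in> {t_init G..t_final G} \<Longrightarrow> transpose (P t) = P t"
  using ric by (auto simp: riccati_solution_def)

lemma continuous_P: "continuous_on {t_init G..t_final G} P"
  using ric by (auto simp: riccati_solution_def)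

lemma P_final: "P (t_final G) = mat_QT G"
  using ric by (auto simp: riccati_solution_def)

lemma step_bounds:
  assumes "Suc k < length \<pi>"
  shows "0 < step k" "step k \<le> t_final G - t_init G" "step k \<le> mesh \<pi>"
  using partition_of_nth(1)[OF part, of k "Suc k"] partition_nth_bounds[OF part, of k]
    partition_nth_bounds[OF part, of "Suc k"] step_le_mesh[OF assms] assms by auto

lemma interval_subset:
  assumes "Suc k < length \<pi>"
  shows "{\<pi> ! k..\<pi> ! Suc k} \<subseteq> {t_init G..t_final G}"
  using partition_nth_bounds[OF part, of k] partition_nth_bounds[OF part, of "Suc k"] assms by auto

lemma mesh_pos: "0 < mesh \<pi>"
  using step_bounds[of 0] partition_of_length[OF part time] by force

lemma step_size_bounds:
  assumes "t \<in> {t_init G..t_final G}"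
  shows "0 < step_size \<pi> t" "step_size \<pi> t \<le> t_final G - t_init G" "step_size \<pi> t \<le> mesh \<pi>"
  using step_bounds[OF interval_index_props(1)[OF part time assms]] by (simp_all add: step_size_def)

text \<open>The eigenvalue is the Rayleigh quotient at the unit vector \<open>v2 t\<close>. The term
  with \<open>mat_R2\<close> is retained because it is what makes the eigenvalue negative for small
  steps.\<close>

lemma top_eigenvalue_le:
  assumes t: "t \<in> {t_init G..t_final G}"
  shows "lambda_max (Q2eq G \<pi> P t)
    \<le> step_size \<pi> t * ((norm (mat_B2 G))\<^sup>2 * norm (P t)) - v2 t \<bullet> (mat_R2 G *v v2 t)"
proof -
  let ?M = "transpose (mat_B2 G) ** P t ** mat_B2 G"
  have v: "norm (v2 t) = 1" "Q2eq G \<pi> P t *v v2 t = lambda_max (Q2eq G \<pi> P t) *\<^sub>R v2 t"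
    using top t by (auto simp: top_eigenvector_def)
  have "lambda_max (Q2eq G \<pi> P t) = v2 t \<bullet> (Q2eq G \<pi> P t *v v2 t)"
    using v(1) by (simp add: v(2) norm_eq_1)
  also have "\<dots> = step_size \<pi> t * (v2 t \<bullet> (?M *v v2 t)) - v2 t \<bullet> (mat_R2 G *v v2 t)"
    by (simp add: Q2eq_def matrix_vector_mult_diff_rdistrib inner_diff_right flip: scaleR_matrix_vector_assoc)
  also have "v2 t \<bullet> (?M *v v2 t) \<le> norm ?M"
    using quadratic_form_le[of "v2 t" ?M] v(1) by simp
  also have "norm ?M \<le> norm (transpose (mat_B2 G)) * norm (P t) * norm (mat_B2 G)"
    by (intro order_trans[OF norm_matrix_mult_le] mult_right_mono norm_matrix_mult_le) simp
  also have "\<dots> = (norm (mat_B2 G))\<^sup>2 * norm (P t)"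
    by (simp add: power2_eq_square)
  finally show ?thesis
    using step_size_bounds(1)[OF t] by (simp add: mult_left_mono)
qed

lemma lam2_le:
  assumes t: "t \<in> {t_init G..t_final G}"
  shows "lam2 G \<pi> P t \<le> (t_final G - t_init G) * (norm (mat_B2 G))\<^sup>2 * norm (P t)"
proof -
  have "0 \<le> v2 t \<bullet> (mat_R2 G *v v2 t)"
    using R2_pos_def unfolding pos_def_def by (cases "v2 t = 0") (auto intro: less_imp_le)
  moreover have "step_size \<pi> t * ((norm (mat_B2 G))\<^sup>2 * norm (P t))
      \<le> (t_final G - t_init G) * ((norm (mat_B2 G))\<^sup>2 * norm (P t))"
    by (intro mult_right_mono step_size_bounds(2)[OF t]) simp
  ultimately have "lambda_max (Q2eq G \<pi> P t) \<le> (t_final G - t_init G) * ((norm (mat_B2 G))\<^sup>2 * norm (P t))"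
    using top_eigenvalue_le[OF t] by linarith
  then show ?thesis
    using time by (simp add: lam2_def mult.assoc)
qed

text \<open>The right-hand side of the Riccati equation with one factor \<open>P t\<close> of each
  quadratic term absorbed into a gain; bounded gains then leave an expression of linear
  growth.\<close>

definition P' where
  "P' t = - (transpose (mat_A G) ** P t + P t ** mat_A G + mat_Q G
      - P t ** mat_B1 G ** K1 G P t + P t ** mat_B2 G ** K2 G \<pi> P t
      + mat (lam2 G \<pi> P t * (gam2 G)\<^sup>2))"

lemma P_has_vector_derivative:
  assumes k: "Suc k < length \<pi>" and t: "t \<in> {\<pi> ! k<..<\<pi> ! Suc k}"
  shows "(P has_vector_derivative P' t) (at t)"
proof -
  have "(P has_vector_derivative P' t) (at t within {\<pi> ! k..<\<pi> ! Suc k})"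
    using ric k t unfolding riccati_solution_def P'_def K1_def K2_def
    by (auto simp: matrix_mul_assoc)
  then have "(P has_vector_derivative P' t) (at t within {\<pi> ! k<..<\<pi> ! Suc k})"
    by (rule has_vector_derivative_within_subset) auto
  then show ?thesis
    using t by (simp add: at_within_open[OF _ open_greaterThanLessThan])
qed

lemma norm_P'_le:
  assumes t: "t \<in> {t_init G..t_final G}"
  shows "norm (P' t) \<le> riccati_offset G + riccati_slope G * norm (P t)"
proof -
  have K: "norm (K1 G P t) \<le> real CARD('n) * gam1 G" "norm (K2 G \<pi> P t) \<le> real CARD('n) * gam2 G"
    using gain_bounds[OF data ric cap t] by (auto intro: norm_matrix_le_of_operator_bound)
  have "norm (P t ** mat_B1 G ** K1 G P t) \<le> norm (P t) * norm (mat_B1 G) * (real CARD('n) * gam1 G)"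
    by (intro order_trans[OF norm_matrix_mult_le] mult_mono norm_matrix_mult_le K) auto
  moreover have "norm (P t ** mat_B2 G ** K2 G \<pi> P t) \<le> norm (P t) * norm (mat_B2 G) * (real CARD('n) * gam2 G)"
    by (intro order_trans[OF norm_matrix_mult_le] mult_mono norm_matrix_mult_le K) auto
  moreover have "norm (transpose (mat_A G) ** P t) \<le> norm (mat_A G) * norm (P t)"
    using norm_matrix_mult_le[of "transpose (mat_A G)" "P t"] by simp
  moreover have "norm (P t ** mat_A G) \<le> norm (P t) * norm (mat_A G)"
    by (rule norm_matrix_mult_le)
  moreover have "norm (mat (lam2 G \<pi> P t * (gam2 G)\<^sup>2) :: real^'n^'n)
      \<le> real CARD('n) * ((t_final G - t_init G) * (norm (mat_B2 G))\<^sup>2 * norm (P t) * (gam2 G)\<^sup>2)"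
  proof (rule order_trans[OF norm_mat_le mult_left_mono])
    show "\<bar>lam2 G \<pi> P t * (gam2 G)\<^sup>2\<bar> \<le> (t_final G - t_init G) * (norm (mat_B2 G))\<^sup>2 * norm (P t) * (gam2 G)\<^sup>2"
      using lam2_le[OF t] by (simp add: abs_mult lam2_def mult_right_mono)
  qed simp
  moreover have "norm (P' t) \<le> norm (transpose (mat_A G) ** P t) + norm (P t ** mat_A G) + norm (mat_Q G)
      + norm (P t ** mat_B1 G ** K1 G P t) + norm (P t ** mat_B2 G ** K2 G \<pi> P t)
      + norm (mat (lam2 G \<pi> P t * (gam2 G)\<^sup>2) :: real^'n^'n)"
    unfolding P'_def norm_minus_cancel
    by (intro norm_triangle_le add_mono order_trans[OF norm_triangle_ineq4] norm_triangle_ineq order_refl)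
  ultimately show ?thesis
    unfolding riccati_offset_def riccati_slope_def by (simp add: algebra_simps)
qed

lemma riccati_slope_nonneg: "0 \<le> riccati_slope G"
  unfolding riccati_slope_def using gam time by (intro add_nonneg_nonneg mult_nonneg_nonneg) auto

lemma riccati_bound_nonneg: "0 \<le> riccati_bound G"
  unfolding riccati_bound_def by simp

text \<open>Gronwall's argument, run backwards from the terminal time: the weight makes the function
  nondecreasing.\<close>

lemma P_energy_mono:
  assumes k: "Suc k < length \<pi>" and s: "s \<in> {\<pi> ! k..\<pi> ! Suc k}"
  defines "\<phi> \<equiv> \<lambda>t. (P t \<bullet> P t + (riccati_offset G)\<^sup>2) * exp ((1 + 2 * riccati_slope G) * t)"
  shows "\<phi> s \<le> \<phi> (\<pi> ! Suc k)"
\<comment> \<open>A two-sided derivative is at hand only inside the interval; continuity carries the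
  monotonicity to the end points.\<close>
proof (rule DERIV_nonneg_imp_increasing_open[where f = \<phi>])
  let ?a = "riccati_offset G" and ?b = "riccati_slope G"
  show "s \<le> \<pi> ! Suc k" using s by simp
  have "{s..\<pi> ! Suc k} \<subseteq> {t_init G..t_final G}"
    using interval_subset[OF k] s by auto
  then show "continuous_on {s..\<pi> ! Suc k} \<phi>"
    unfolding \<phi>_def by (intro continuous_intros continuous_on_subset[OF continuous_P])
  fix t assume t: "s < t" "t < \<pi> ! Suc k"
  then have "(P has_vector_derivative P' t) (at t)"
    using s by (intro P_has_vector_derivative[OF k]) auto
  then have "((\<lambda>t. P t \<bullet> P t) has_derivative (\<lambda>h. P t \<bullet> (h *\<^sub>R P' t) + (h *\<^sub>R P' t) \<bullet> P t)) (at t)"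
    unfolding has_vector_derivative_def by (intro has_derivative_inner)
  then have "((\<lambda>t. P t \<bullet> P t) has_real_derivative 2 * (P t \<bullet> P' t)) (at t)"
    unfolding has_field_derivative_def
    by (rule has_derivative_eq_rhs) (auto simp: inner_commute)
  then have der: "(\<phi> has_real_derivative (2 * (P t \<bullet> P' t) + (1 + 2 * ?b) * (P t \<bullet> P t + ?a\<^sup>2))
      * exp ((1 + 2 * ?b) * t)) (at t)"
    unfolding \<phi>_def by (auto intro!: derivative_eq_intros simp: algebra_simps)
  have t': "t \<in> {t_init G..t_final G}"
    using interval_subset[OF k] t s by auto
  have "\<bar>P t \<bullet> P' t\<bar> \<le> norm (P t) * (?a + ?b * norm (P t))"
    by (intro order_trans[OF Cauchy_Schwarz_ineq2] mult_left_mono norm_P'_le t') simp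
  \<comment> \<open>Young's inequality for the mixed term. Its two squares account for the summand 1
    in the exponential rate and for the squared offset in the energy.\<close>
  moreover have "2 * (norm (P t) * ?a) \<le> (norm (P t))\<^sup>2 + ?a\<^sup>2"
    using zero_le_power2[of "norm (P t) - ?a"] by (simp add: power2_diff)
  ultimately have "0 \<le> 2 * (P t \<bullet> P' t) + (1 + 2 * ?b) * (P t \<bullet> P t) + ?a\<^sup>2"
    unfolding power2_norm_eq_inner[symmetric] by (simp add: algebra_simps power2_eq_square abs_le_iff)
  also have "\<dots> \<le> 2 * (P t \<bullet> P' t) + (1 + 2 * ?b) * (P t \<bullet> P t + ?a\<^sup>2)"
    using riccati_slope_nonneg by (simp add: algebra_simps)
  finally show "\<exists>y. (\<phi> has_real_derivative y) (at t) \<and> 0 \<le> y"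
    using der by fastforce
qed

text \<open>The weighted energy increases on each interval and, by way of the common grid points, up
  to the final time, where the terminal condition gives its value.\<close>

lemma norm_P_le:
  assumes t: "t \<in> {t_init G..t_final G}"
  shows "norm (P t) \<le> riccati_bound G"
proof -
  define \<phi> where "\<phi> t = (P t \<bullet> P t + (riccati_offset G)\<^sup>2) * exp ((1 + 2 * riccati_slope G) * t)" for t
  have mono: "\<phi> s \<le> \<phi> (\<pi> ! Suc k)" if "Suc k < length \<pi>" "s \<in> {\<pi> ! k..\<pi> ! Suc k}" for k s
    using P_energy_mono[OF that] by (simp add: \<phi>_def)
  have grid: "\<phi> (\<pi> ! k) \<le> \<phi> (t_final G)" if "k \<le> length \<pi> - 1" for k
    using that
  proof (induction rule: inc_induct)
    case base
    then show ?case using partition_of_nth(3)[OF part] by simp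
  next
    case (step k)
    then show ?case
      using mono[of k "\<pi> ! k"] step_bounds[of k] by force
  qed
  let ?i = "interval_index \<pi> t"
  note i = interval_index_props[OF part time t]
  have "\<phi> t \<le> \<phi> (\<pi> ! Suc ?i)"
    using i by (intro mono) auto
  also have "\<dots> \<le> \<phi> (t_final G)"
    using i(1) by (intro grid) simp
  finally have "P t \<bullet> P t + (riccati_offset G)\<^sup>2
      \<le> ((norm (mat_QT G))\<^sup>2 + (riccati_offset G)\<^sup>2) * exp ((1 + 2 * riccati_slope G) * (t_final G - t))"
    by (simp add: \<phi>_def P_final power2_norm_eq_inner right_diff_distrib exp_diff field_simps)
  also have "\<dots> \<le> ((norm (mat_QT G))\<^sup>2 + (riccati_offset G)\<^sup>2)
      * exp ((1 + 2 * riccati_slope G) * (t_final G - t_init G))"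
    using t riccati_slope_nonneg by (intro mult_left_mono) (auto intro!: mult_left_mono)
  finally have "(norm (P t))\<^sup>2 \<le> ((norm (mat_QT G))\<^sup>2 + (riccati_offset G)\<^sup>2)
      * exp ((1 + 2 * riccati_slope G) * (t_final G - t_init G))"
    unfolding power2_norm_eq_inner by (rule order_trans[rotated]) simp
  then show ?thesis
    unfolding riccati_bound_def by (rule real_le_rsqrt)
qed

text \<open>Mean value inequality within one interval, with the growth bound evaluated at
  \<open>riccati_bound\<close>.\<close>

lemma P_lipschitz:
  assumes k: "Suc k < length \<pi>" and s: "0 \<le> s" "s \<le> step k"
  shows "norm (P (\<pi> ! k + s) - P (\<pi> ! k)) \<le> riccati_speed G * s"
proof (cases "s = 0")
  case False
  have sub: "{\<pi> ! k..\<pi> ! k + s} \<subseteq> {t_init G..t_final G}"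
    using interval_subset[OF k] s by auto
  have "\<exists>t\<in>{\<pi> ! k<..<\<pi> ! k + s}. norm (P (\<pi> ! k + s) - P (\<pi> ! k)) \<le> norm ((\<pi> ! k + s - \<pi> ! k) *\<^sub>R P' t)"
    using s False P_has_vector_derivative[OF k]
    by (intro mvt_general continuous_on_subset[OF continuous_P sub]) (auto simp: has_vector_derivative_def)
  then obtain t where t: "t \<in> {\<pi> ! k<..<\<pi> ! k + s}"
    "norm (P (\<pi> ! k + s) - P (\<pi> ! k)) \<le> s * norm (P' t)"
    using s by auto
  then have "t \<in> {t_init G..t_final G}" using sub by auto
  then have "norm (P' t) \<le> riccati_speed G"
    using norm_P'_le[of t] mult_left_mono[OF norm_P_le[of t] riccati_slope_nonneg]
    unfolding riccati_speed_def by simp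
  then have "s * norm (P' t) \<le> s * riccati_speed G"
    using s by (intro mult_left_mono)
  then show ?thesis using t(2) by (simp add: mult.commute)
qed simp

end

subsection \<open>Completing the square\<close>

text \<open>Separates the feedback error at the sampling time, which the player controls, from its
  change during the interval.\<close>

lemma quadratic_perturbation_le:
  fixes R :: "real^'n^'n"
  shows "a \<bullet> (R *v a) \<le> 2 * norm R * (norm b)\<^sup>2 + 2 * norm R * (norm (a - b))\<^sup>2"
proof -
  have "norm a \<le> norm b + norm (a - b)"
    by (metis add_diff_cancel_left' diff_add_cancel norm_triangle_ineq add.commute)
  then have "(norm a)\<^sup>2 \<le> (norm b + norm (a - b))\<^sup>2"
    by (intro power_mono) auto
  also have "\<dots> \<le> 2 * (norm b)\<^sup>2 + 2 * (norm (a - b))\<^sup>2"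
    using zero_le_power2[of "norm b - norm (a - b)"] by (simp add: power2_sum power2_diff)
  finally have "norm R * (norm a)\<^sup>2 \<le> norm R * (2 * (norm b)\<^sup>2 + 2 * (norm (a - b))\<^sup>2)"
    by (intro mult_left_mono) auto
  then show ?thesis
    using quadratic_form_le[of a R] by (simp add: algebra_simps)
qed

lemma complete_square:
  fixes R S :: "real^'n^'n"
  assumes "R ** S = mat 1" "transpose R = R"
  shows "(a + S *v q) \<bullet> (R *v (a + S *v q)) = a \<bullet> (R *v a) + 2 * (a \<bullet> q) + q \<bullet> (S *v q)"
proof -
  have RS: "R *v (S *v q) = q"
    by (simp add: matrix_vector_mul_assoc assms(1))
  have "(S *v q) \<bullet> (R *v a) = q \<bullet> a"
    by (simp add: inner_matrix_transpose assms(2) RS)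
  then show ?thesis
    by (simp add: matrix_vector_right_distrib inner_add_left inner_add_right RS inner_commute)
qed

text \<open>The 6 is 2 from \<open>quadratic_perturbation_le\<close> times 3 from
  \<open>sq_sum_le_sq_size\<close>; \<open>norm W\<close> belongs to the map from P y to the
  feedback; the bracket is a Lipschitz constant in time of P y by the product rule.\<close>

definition sampling_error :: "('n::finite, 'p::finite, 'q::finite) lq_game \<Rightarrow> real^'n^'m \<Rightarrow> real^'m^'m \<Rightarrow> real" where
  "sampling_error G W R = 6 * norm R * (norm W)\<^sup>2 * (riccati_bound G * flow_rate G + riccati_speed G)\<^sup>2"

lemma sampling_error_nonneg [simp]: "0 \<le> sampling_error G W R"
  by (simp add: sampling_error_def)

context riccati_game
begin

abbreviation "K\<^sub>1 k \<equiv> K1 G P (\<pi> ! k)"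
abbreviation "K\<^sub>2 k \<equiv> K2 G \<pi> P (\<pi> ! k)"
abbreviation "W\<^sub>1 \<equiv> matrix_inv (mat_R1 G) ** transpose (mat_B1 G)"
abbreviation "W\<^sub>2 \<equiv> matrix_inv (mat_R2 G) ** transpose (mat_B2 G)"

text \<open>Product rule for increments: \<open>P\<close> is bounded while the state moves, and the
  increment of \<open>P\<close> acts on the initial state. Both parts are proportional to the
  elapsed time.\<close>

lemma feedback_drift_le:
  fixes x :: "real^'n" and w :: "(real^'p) \<times> (real^'q)"
  assumes k: "Suc k < length \<pi>" and s: "0 \<le> s" "s \<le> step k"
  defines "y \<equiv> hold_flow G x w s"
  shows "(norm (P (\<pi> ! k + s) *v y - P (\<pi> ! k) *v x))\<^sup>2
    \<le> 3 * (riccati_bound G * flow_rate G + riccati_speed G)\<^sup>2 * (step k)\<^sup>2 * sq_size x w"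
proof -
  let ?n = "norm x + norm (fst w) + norm (snd w)"
  let ?c = "riccati_bound G * flow_rate G + riccati_speed G"
  have t: "\<pi> ! k + s \<in> {t_init G..t_final G}"
    using interval_subset[OF k] s by auto
  have "P (\<pi> ! k + s) *v y - P (\<pi> ! k) *v x = P (\<pi> ! k + s) *v (y - x) + (P (\<pi> ! k + s) - P (\<pi> ! k)) *v x"
    by (simp add: matrix_vector_mult_diff_distrib matrix_vector_mult_diff_rdistrib)
  also have "norm \<dots> \<le> norm (P (\<pi> ! k + s)) * norm (y - x) + norm (P (\<pi> ! k + s) - P (\<pi> ! k)) * norm x"
    by (intro norm_triangle_le add_mono norm_matrix_vector_mult_le)
  also have "\<dots> \<le> riccati_bound G * (s * flow_rate G * ?n) + (riccati_speed G * s) * ?n"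
    unfolding y_def using s step_bounds(2)[OF k]
    by (intro add_mono mult_mono norm_P_le[OF t] hold_flow_increment_le P_lipschitz[OF k])
      (auto simp: riccati_bound_nonneg intro!: mult_nonneg_nonneg add_nonneg_nonneg order_trans[OF norm_ge_zero P_lipschitz[OF k]])
  also have "\<dots> = s * (?c * ?n)"
    by (simp add: algebra_simps)
  also have "\<dots> \<le> step k * (?c * ?n)"
    using s by (intro mult_right_mono mult_nonneg_nonneg add_nonneg_nonneg)
      (auto simp: riccati_bound_nonneg riccati_speed_def riccati_offset_def riccati_slope_nonneg)
  finally have "(norm (P (\<pi> ! k + s) *v y - P (\<pi> ! k) *v x))\<^sup>2 \<le> (step k * (?c * ?n))\<^sup>2"
    by (intro power_mono) auto
  also have "\<dots> = ?c\<^sup>2 * (step k)\<^sup>2 * ?n\<^sup>2"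
    by (simp add: power_mult_distrib)
  also have "\<dots> \<le> ?c\<^sup>2 * (step k)\<^sup>2 * (3 * sq_size x w)"
    by (intro mult_left_mono sq_sum_le_sq_size) auto
  finally show ?thesis by (simp add: mult_ac)
qed

text \<open>\<open>W\<close>, \<open>R\<close> and \<open>a\<close> stay general so that one
  estimate serves both players: \<open>a\<close> is the control of the minimizer or minus the
  control of the maximizer.\<close>

lemma feedback_defect_le:
  fixes x :: "real^'n" and w :: "(real^'p) \<times> (real^'q)" and W :: "real^'n^'m" and R :: "real^'m^'m" and a :: "real^'m"
  assumes k: "Suc k < length \<pi>" and s: "0 \<le> s" "s \<le> step k"
  defines "y \<equiv> hold_flow G x w s"
  defines "b \<equiv> a + W *v (P (\<pi> ! k + s) *v y)"
  shows "b \<bullet> (R *v b) \<le> 2 * norm R * (norm (a + W *v (P (\<pi> ! k) *v x)))\<^sup>2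
    + sampling_error G W R * (step k)\<^sup>2 * sq_size x w"
proof -
  let ?b0 = "a + W *v (P (\<pi> ! k) *v x)"
  let ?d = "P (\<pi> ! k + s) *v y - P (\<pi> ! k) *v x"
  let ?c = "riccati_bound G * flow_rate G + riccati_speed G"
  have "b - ?b0 = W *v ?d"
    by (simp add: b_def matrix_vector_mult_diff_distrib)
  then have "(norm (b - ?b0))\<^sup>2 \<le> (norm W * norm ?d)\<^sup>2"
    using norm_matrix_vector_mult_le[of W ?d] by (simp add: power_mono)
  also have "\<dots> = (norm W)\<^sup>2 * (norm ?d)\<^sup>2"
    by (rule power_mult_distrib)
  also have "\<dots> \<le> (norm W)\<^sup>2 * (3 * ?c\<^sup>2 * (step k)\<^sup>2 * sq_size x w)"
    unfolding y_def by (intro mult_left_mono feedback_drift_le[OF k s]) simp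
  finally have "2 * norm R * (norm (b - ?b0))\<^sup>2 \<le> 2 * norm R * ((norm W)\<^sup>2 * (3 * ?c\<^sup>2 * (step k)\<^sup>2 * sq_size x w))"
    by (intro mult_left_mono) auto
  also have "\<dots> = sampling_error G W R * (step k)\<^sup>2 * sq_size x w"
    by (simp add: sampling_error_def)
  finally show ?thesis
    using quadratic_perturbation_le[of b R ?b0] by simp
qed

text \<open>The time derivative of \<open>y \<bullet> (P t *v y)\<close> along the flow under held
  controls.\<close>

definition value_rate where
  "value_rate t y w =
     drift G y w \<bullet> (P t *v y) + y \<bullet> (P t *v drift G y w + P' t *v y)"

text \<open>The Riccati equation cancels the terms with \<open>mat_A\<close> and
  \<open>mat_Q\<close>, and its quadratic terms are those missing for two complete squares.
  Vanishing \<open>lam2\<close> removes the shift of \<open>mat_R2\<close> and the term with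
  \<open>gam2\<close>. The maximizer enters as \<open>- snd w\<close> because its feedback has the
  opposite sign.\<close>

lemma running_cost_plus_value_rate:
  fixes y :: "real^'n" and w :: "(real^'p) \<times> (real^'q)"
  assumes t: "t \<in> {t_init G..t_final G}" and lam: "lam2 G \<pi> P t = 0"
  defines "a \<equiv> fst w + W\<^sub>1 *v (P t *v y)" and "b \<equiv> - snd w + W\<^sub>2 *v (P t *v y)"
  shows "running_cost G y w + value_rate t y w = a \<bullet> (mat_R1 G *v a) - b \<bullet> (mat_R2 G *v b)"
proof -
  let ?p = "P t *v y"
  let ?q1 = "transpose (mat_B1 G) *v ?p" and ?q2 = "transpose (mat_B2 G) *v ?p"
  let ?S1 = "matrix_inv (mat_R1 G)" and ?S2 = "matrix_inv (mat_R2 G)"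
  have symP: "z \<bullet> (P t *v z') = (P t *v z) \<bullet> z'" for z z'
    by (simp add: inner_matrix_transpose P_symmetric[OF t])
  have P'y: "y \<bullet> (P' t *v y) = - (2 * (?p \<bullet> (mat_A G *v y)) + y \<bullet> (mat_Q G *v y)
      - ?q1 \<bullet> (?S1 *v ?q1) + ?q2 \<bullet> (?S2 *v ?q2))"
  proof -
    have "y \<bullet> ((transpose (mat_A G) ** P t) *v y) = ?p \<bullet> (mat_A G *v y)"
      by (simp only: inner_matrix_transpose[of y "transpose (mat_A G)"] transpose_transpose inner_commute[of "mat_A G *v y"]
          flip: matrix_vector_mul_assoc)
    moreover have "y \<bullet> ((P t ** mat_A G) *v y) = ?p \<bullet> (mat_A G *v y)"
      by (simp add: symP flip: matrix_vector_mul_assoc)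
    moreover have "y \<bullet> ((P t ** mat_B1 G ** K1 G P t) *v y) = ?q1 \<bullet> (?S1 *v ?q1)"
      by (simp only: K1_def symP inner_matrix_transpose[of ?p "mat_B1 G"] flip: matrix_vector_mul_assoc)
    moreover have "y \<bullet> ((P t ** mat_B2 G ** K2 G \<pi> P t) *v y) = ?q2 \<bullet> (?S2 *v ?q2)"
      by (simp only: K2_def lam mat_zero add_0_right symP inner_matrix_transpose[of ?p "mat_B2 G"] flip: matrix_vector_mul_assoc)
    ultimately show ?thesis
      unfolding P'_def lam
      by (simp add: mat_zero matrix_vector_mult_minus_left matrix_vector_mult_add_rdistrib
          matrix_vector_mult_diff_rdistrib inner_add_right inner_diff_right)
  qed
  have dr: "drift G y w \<bullet> ?p = ?p \<bullet> (mat_A G *v y) + fst w \<bullet> ?q1 + snd w \<bullet> ?q2"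
    unfolding drift_def inner_add_left
    by (simp only: inner_commute[of _ ?p] inner_matrix_transpose[of ?p "mat_B1 G"] inner_matrix_transpose[of ?p "mat_B2 G"]
        inner_commute[of ?q1] inner_commute[of ?q2])
  have "a \<bullet> (mat_R1 G *v a) = fst w \<bullet> (mat_R1 G *v fst w) + 2 * (fst w \<bullet> ?q1) + ?q1 \<bullet> (?S1 *v ?q1)"
    unfolding a_def matrix_vector_mul_assoc[symmetric, of ?S1]
    using R1_pos_def by (intro complete_square pos_def_inverse) (auto simp: pos_def_def)
  moreover have "b \<bullet> (mat_R2 G *v b) = (- snd w) \<bullet> (mat_R2 G *v (- snd w)) + 2 * ((- snd w) \<bullet> ?q2) + ?q2 \<bullet> (?S2 *v ?q2)"
    unfolding b_def matrix_vector_mul_assoc[symmetric, of ?S2]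
    using R2_pos_def by (intro complete_square pos_def_inverse) (auto simp: pos_def_def)
  moreover have "(- snd w) \<bullet> (mat_R2 G *v (- snd w)) = snd w \<bullet> (mat_R2 G *v snd w)"
    by (simp add: linear_neg[OF matrix_vector_mul_linear])
  moreover have "value_rate t y w = 2 * (drift G y w \<bullet> ?p) + y \<bullet> (P' t *v y)"
    unfolding value_rate_def inner_add_right symP[of y "drift G y w"] by (simp add: inner_commute[of ?p])
  ultimately show ?thesis
    unfolding running_cost_def by (simp add: dr P'y)
qed

abbreviation "val k x \<equiv> x \<bullet> (P (\<pi> ! k) *v x)"

lemma value_rate_has_integral:
  assumes k: "Suc k < length \<pi>"
  shows "((\<lambda>s. value_rate (\<pi> ! k + s) (hold_flow G x w s) w)
    has_integral (val (Suc k) (hold_flow G x w (step k)) - val k x)) {0..step k}"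
proof -
  let ?y = "hold_flow G x w"
  let ?\<phi> = "\<lambda>s. ?y s \<bullet> (P (\<pi> ! k + s) *v ?y s)"
  have contP: "continuous_on {0..step k} (\<lambda>s. P (\<pi> ! k + s))"
    using interval_subset[OF k]
    by (intro continuous_on_compose2[OF continuous_P] continuous_intros) auto
  have "((\<lambda>s. value_rate (\<pi> ! k + s) (?y s) w) has_integral (?\<phi> (step k) - ?\<phi> 0)) {0..step k}"
  \<comment> \<open>The interior version is chosen because the right-hand side of the Riccati
    equation may jump at grid points.\<close>
  proof (rule fundamental_theorem_of_calculus_interior)
    show "0 \<le> step k" using step_bounds(1)[OF k] by simp
    show "continuous_on {0..step k} ?\<phi>"
      by (intro continuous_on_inner continuous_on_hold_flow
          bounded_bilinear.continuous_on[OF bounded_bilinear_matrix_vector, simplified] contP)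
    fix s assume s: "s \<in> {0<..<step k}"
    have y: "(?y has_vector_derivative drift G (?y s) w) (at s)"
      by (rule hold_flow_has_vector_derivative)
    have "(P has_vector_derivative P' (\<pi> ! k + s)) (at (\<pi> ! k + s))"
      using s by (intro P_has_vector_derivative[OF k]) auto
    moreover have "((\<lambda>s. \<pi> ! k + s) has_vector_derivative 1) (at s)"
      unfolding has_real_derivative_iff_has_vector_derivative[symmetric]
      by (auto intro!: derivative_eq_intros)
    ultimately have "((\<lambda>s. P (\<pi> ! k + s)) has_vector_derivative P' (\<pi> ! k + s)) (at s)"
      using vector_diff_chain_at[of "\<lambda>s. \<pi> ! k + s" 1 s P "P' (\<pi> ! k + s)"]
      by (simp add: o_def)
    from bounded_bilinear.has_vector_derivative[OF bounded_bilinear_matrix_vector this y]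
    have "((\<lambda>s. P (\<pi> ! k + s) *v ?y s) has_vector_derivative
        P (\<pi> ! k + s) *v drift G (?y s) w + P' (\<pi> ! k + s) *v ?y s) (at s)"
      by simp
    from bounded_bilinear.has_vector_derivative[OF bounded_bilinear_inner y this]
    show "(?\<phi> has_vector_derivative value_rate (\<pi> ! k + s) (?y s) w) (at s)"
      by (simp add: value_rate_def add.commute)
  qed
  then show ?thesis by simp
qed

text \<open>Each bound drops one square by its sign: the upper one that of the maximizer, the lower
  one that of the minimizer. The opponent's control then remains only in \<open>sq_size\<close>,
  with the weight \<open>(step k)\<^sup>2\<close>.\<close>

lemma one_step:
  fixes x :: "real^'n" and w :: "(real^'p) \<times> (real^'q)"
  assumes k: "Suc k < length \<pi>" and lam: "\<And>t. t \<in> {t_init G..t_final G} \<Longrightarrow> lam2 G \<pi> P t = 0"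
  defines "I \<equiv> stage_cost G x w (step k) + val (Suc k) (hold_flow G x w (step k)) - val k x"
  shows "I \<le> step k * (2 * norm (mat_R1 G) * (norm (fst w + K\<^sub>1 k *v x))\<^sup>2
      + sampling_error G W\<^sub>1 (mat_R1 G) * (step k)\<^sup>2 * sq_size x w)"
    and "- (step k * (2 * norm (mat_R2 G) * (norm (- snd w + K\<^sub>2 k *v x))\<^sup>2
      + sampling_error G W\<^sub>2 (mat_R2 G) * (step k)\<^sup>2 * sq_size x w)) \<le> I"
proof -
  let ?y = "hold_flow G x w"
  let ?f = "\<lambda>s. running_cost G (?y s) w + value_rate (\<pi> ! k + s) (?y s) w"
  have int: "(?f has_integral I) {0..step k}"
    using has_integral_add[OF stage_cost_has_integral value_rate_has_integral[OF k], of G x w x w]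
    by (simp add: I_def add_diff_eq)
  have \<delta>: "0 < step k" by (rule step_bounds(1)[OF k])
  have tk: "\<pi> ! k \<in> {t_init G..t_final G}"
    using partition_nth_bounds[OF part, of k] k by simp
  let ?a = "\<lambda>s. fst w + W\<^sub>1 *v (P (\<pi> ! k + s) *v ?y s)"
  let ?b = "\<lambda>s. - snd w + W\<^sub>2 *v (P (\<pi> ! k + s) *v ?y s)"
  have f: "?f s = ?a s \<bullet> (mat_R1 G *v ?a s) - ?b s \<bullet> (mat_R2 G *v ?b s)" if "s \<in> {0..step k}" for s
  proof -
    have "\<pi> ! k + s \<in> {t_init G..t_final G}"
      using interval_subset[OF k] that by auto
    then show ?thesis
      by (intro running_cost_plus_value_rate lam)
  qed
  have nonneg: "0 \<le> z \<bullet> (mat_R1 G *v z)" "0 \<le> z' \<bullet> (mat_R2 G *v z')" for z z'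
    using R1_pos_def R2_pos_def unfolding pos_def_def
    by (cases "z = 0"; cases "z' = 0"; auto intro: less_imp_le)+
  have K: "K\<^sub>1 k *v x = W\<^sub>1 *v (P (\<pi> ! k) *v x)" "K\<^sub>2 k *v x = W\<^sub>2 *v (P (\<pi> ! k) *v x)"
    by (simp_all add: K1_def K2_def lam[OF tk] mat_zero matrix_vector_mul_assoc)
  let ?U = "2 * norm (mat_R1 G) * (norm (fst w + K\<^sub>1 k *v x))\<^sup>2
      + sampling_error G W\<^sub>1 (mat_R1 G) * (step k)\<^sup>2 * sq_size x w"
  let ?L = "2 * norm (mat_R2 G) * (norm (- snd w + K\<^sub>2 k *v x))\<^sup>2
      + sampling_error G W\<^sub>2 (mat_R2 G) * (step k)\<^sup>2 * sq_size x w"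
  have "?f s \<le> ?U" "- ?L \<le> ?f s" if s: "s \<in> {0..step k}" for s
    using feedback_defect_le[OF k, of s "fst w" W\<^sub>1 x w "mat_R1 G"]
      feedback_defect_le[OF k, of s "- snd w" W\<^sub>2 x w "mat_R2 G"] s nonneg(1)[of "?a s"] nonneg(2)[of "?b s"]
    unfolding f[OF s] K by auto
  then have "I \<le> step k *\<^sub>R ?U" "step k *\<^sub>R (- ?L) \<le> I"
    using has_integral_le[OF int has_integral_const_real[of ?U 0 "step k"]]
      has_integral_le[OF has_integral_const_real[of "- ?L" 0 "step k"] int] \<delta>
    by auto
  then show "I \<le> step k * ?U" "- (step k * ?L) \<le> I"
    unfolding real_scaleR_def mult_minus_right .
qed

text \<open>The increments of \<open>val\<close> telescope, and their last term is the terminal cost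
  because \<open>P\<close> ends at \<open>mat_QT G\<close>. The bounds hold for every history,
  before any expectation is taken.\<close>

lemma path_cost_bounds:
  assumes lam: "\<And>t. t \<in> {t_init G..t_final G} \<Longrightarrow> lam2 G \<pi> P t = 0"
  defines "V \<equiv> x_init G \<bullet> (P (t_init G) *v x_init G)"
  shows "path_cost G \<pi> h \<le> V + (\<Sum>k<length \<pi> - 1. step k *
      (2 * norm (mat_R1 G) * (norm (fst (h k) + K\<^sub>1 k *v grid_state G \<pi> h k))\<^sup>2
      + sampling_error G W\<^sub>1 (mat_R1 G) * (step k)\<^sup>2 * sq_size (grid_state G \<pi> h k) (h k)))"
    and "V - (\<Sum>k<length \<pi> - 1. step k *
      (2 * norm (mat_R2 G) * (norm (- snd (h k) + K\<^sub>2 k *v grid_state G \<pi> h k))\<^sup>2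
      + sampling_error G W\<^sub>2 (mat_R2 G) * (step k)\<^sup>2 * sq_size (grid_state G \<pi> h k) (h k))) \<le> path_cost G \<pi> h"
proof -
  let ?N = "length \<pi> - 1" and ?X = "grid_state G \<pi> h"
  let ?I = "\<lambda>k. stage_cost G (?X k) (h k) (step k) + val (Suc k) (?X (Suc k)) - val k (?X k)"
  have "(\<Sum>k<?N. val (Suc k) (?X (Suc k)) - val k (?X k)) = val ?N (?X ?N) - val 0 (?X 0)"
    by (rule sum_lessThan_telescope)
  then have eq: "path_cost G \<pi> h = V + (\<Sum>k<?N. ?I k)"
    using partition_of_nth(2,3)[OF part]
    by (simp add: path_cost_eq[OF part time] V_def P_final sum.distrib sum_subtractf)
  have k: "Suc k < length \<pi>" if "k < ?N" for k
    using that by simp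
  show "path_cost G \<pi> h \<le> V + (\<Sum>k<?N. step k *
      (2 * norm (mat_R1 G) * (norm (fst (h k) + K\<^sub>1 k *v ?X k))\<^sup>2
      + sampling_error G W\<^sub>1 (mat_R1 G) * (step k)\<^sup>2 * sq_size (?X k) (h k)))"
    unfolding eq using one_step(1)[OF k lam, where x = "?X _" and w = "h _"]
    by (intro add_left_mono sum_mono) simp
  have "(\<Sum>k<?N. - (step k *
      (2 * norm (mat_R2 G) * (norm (- snd (h k) + K\<^sub>2 k *v ?X k))\<^sup>2
      + sampling_error G W\<^sub>2 (mat_R2 G) * (step k)\<^sup>2 * sq_size (?X k) (h k)))) \<le> (\<Sum>k<?N. ?I k)"
    unfolding grid_state.simps by (intro sum_mono one_step(2)[OF k lam]) auto
  then show "V - (\<Sum>k<?N. step k *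
      (2 * norm (mat_R2 G) * (norm (- snd (h k) + K\<^sub>2 k *v ?X k))\<^sup>2
      + sampling_error G W\<^sub>2 (mat_R2 G) * (step k)\<^sup>2 * sq_size (?X k) (h k))) \<le> path_cost G \<pi> h"
    unfolding eq sum_negf by linarith
qed

end

section \<open>Negative definiteness on fine partitions\<close>

lemma small_mesh_Q2eq_negative:
  fixes G :: "('n::finite, 'p::finite, 'q::finite) lq_game"
  assumes data: "lq_game_data G"
  obtains \<epsilon> where "0 < \<epsilon>" "\<epsilon> \<le> 1"
    "\<And>\<pi> P v2 t. riccati_game G \<pi> P v2 \<Longrightarrow> mesh \<pi> < \<epsilon> \<Longrightarrow> t \<in> {t_init G..t_final G} \<Longrightarrow> lambda_max (Q2eq G \<pi> P t) < 0"
proof -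
  have "pos_def (mat_R2 G)"
    using data by (simp add: lq_game_data_def)
  then obtain r where r: "0 < r" "\<And>v. r * (norm v)\<^sup>2 \<le> v \<bullet> (mat_R2 G *v v)"
    using pos_def_coercive by blast
  define c where "c = (norm (mat_B2 G))\<^sup>2 * riccati_bound G"
  have c: "0 \<le> c"
    by (simp add: c_def riccati_bound_def)
  show thesis
  proof
    \<comment> \<open>The summand 1 in the denominator covers \<open>c = 0\<close>; the cap at 1 is
      what finally lets the square of the mesh be estimated by its square root.\<close>
    show "0 < min 1 (r / (c + 1))" "min 1 (r / (c + 1)) \<le> 1"
      using r c by (simp_all add: add_nonneg_pos)
    fix \<pi> P v2 t
    assume "riccati_game G \<pi> P v2" and mesh: "mesh \<pi> < min 1 (r / (c + 1))" and t: "t \<in> {t_init G..t_final G}"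
    then interpret riccati_game G \<pi> P v2 by blast
    have "step_size \<pi> t * ((norm (mat_B2 G))\<^sup>2 * norm (P t)) \<le> mesh \<pi> * c"
      unfolding c_def using step_size_bounds[OF t] mesh_pos norm_P_le[OF t]
      by (intro mult_mono mult_left_mono) auto
    also have "\<dots> < r"
    proof -
      have "mesh \<pi> * (c + 1) < r"
        using mesh c by (simp add: pos_less_divide_eq)
      then show ?thesis
        using mesh_pos by (simp add: distrib_left)
    qed
    finally show "lambda_max (Q2eq G \<pi> P t) < 0"
      using top_eigenvalue_le[OF t] r(2)[of "v2 t"] top t by (force simp: top_eigenvector_def)
  qed
qed

section \<open>Expectations of the pathwise bounds\<close>

context strategy_pair
begin

text \<open>Nonnegative integrals yield integrability and the value 0 at once. In the application
  \<open>D\<close> is the distance from a feedback that the player follows exactly, whatever the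
  opponent does.\<close>

lemma zero_defect_integral:
  assumes k: "Suc k < length \<pi>" and D: "case_prod D \<in> borel_measurable (borel \<Otimes>\<^sub>M borel)" "\<And>x w. 0 \<le> D x w"
    and zero: "\<And>x. (\<integral>\<^sup>+w. ennreal (D x w) \<partial>(\<mu> k x \<Otimes>\<^sub>M \<nu> k x)) = 0"
  shows "integrable (law (length \<pi> - 1)) (\<lambda>h. D (X h k) (h k))"
    and "(\<integral>h. D (X h k) (h k) \<partial>law (length \<pi> - 1)) = 0"
proof -
  have k': "k < length \<pi> - 1" "k \<le> length \<pi> - 1" using k by auto
  note [measurable] = measurable_law(1)[OF k'(2)] measurable_law(2)[OF k'(1)] D(1)
  have m: "(\<lambda>h. D (X h k) (h k)) \<in> borel_measurable (law (length \<pi> - 1))"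
    by measurable
  have "(\<lambda>(x, w). ennreal (D x w)) \<in> borel_measurable (borel \<Otimes>\<^sub>M borel)"
    by measurable
  from nn_integral_law_control[OF k this]
  have z: "(\<integral>\<^sup>+h. ennreal (D (X h k) (h k)) \<partial>law (length \<pi> - 1)) = 0"
    by (simp add: zero)
  show int: "integrable (law (length \<pi> - 1)) (\<lambda>h. D (X h k) (h k))"
    by (rule integrableI_nonneg[OF m]) (use D(2) z in auto)
  show "(\<integral>h. D (X h k) (h k) \<partial>law (length \<pi> - 1)) = 0"
    using z unfolding nn_integral_eq_integral[OF int AE_I2[OF D(2)]]
    using Bochner_Integration.integral_nonneg[of "law (length \<pi> - 1)" "\<lambda>h. D (X h k) (h k)"] D(2) by (simp add: order_antisym)
qed

lemma zero_defect_minimizer: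
  assumes k: "Suc k < length \<pi>" and \<mu>: "\<And>x. \<mu> k x = return borel (F *v x)"
  shows "integrable (law (length \<pi> - 1)) (\<lambda>h. (norm (fst (h k) - F *v X h k))\<^sup>2)"
    and "(\<integral>h. (norm (fst (h k) - F *v X h k))\<^sup>2 \<partial>law (length \<pi> - 1)) = 0"
proof -
  let ?D = "\<lambda>x (w :: (real^'p) \<times> (real^'q)). (norm (fst w - F *v x))\<^sup>2"
  have "case_prod ?D \<in> borel_measurable (borel \<Otimes>\<^sub>M borel)"
    unfolding borel_prod[symmetric] by measurable
  moreover have "(\<integral>\<^sup>+w. ennreal (?D x w) \<partial>(\<mu> k x \<Otimes>\<^sub>M \<nu> k x)) = 0" for x
    by (subst nn_integral_pair_fst[OF kernel_props(1,2)[OF k] borel_measurable_kernel(1)[OF k], of "\<lambda>u. ennreal ((norm (u - F *v x))\<^sup>2)"])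
      (auto simp: \<mu> nn_integral_return)
  ultimately show "integrable (law (length \<pi> - 1)) (\<lambda>h. ?D (X h k) (h k))"
    "(\<integral>h. ?D (X h k) (h k) \<partial>law (length \<pi> - 1)) = 0"
    using zero_defect_integral[OF k, of ?D] by auto
qed

lemma zero_defect_maximizer:
  assumes k: "Suc k < length \<pi>" and \<nu>: "\<And>x. \<nu> k x = return borel (F *v x)"
  shows "integrable (law (length \<pi> - 1)) (\<lambda>h. (norm (snd (h k) - F *v X h k))\<^sup>2)"
    and "(\<integral>h. (norm (snd (h k) - F *v X h k))\<^sup>2 \<partial>law (length \<pi> - 1)) = 0"
proof -
  let ?D = "\<lambda>x (w :: (real^'p) \<times> (real^'q)). (norm (snd w - F *v x))\<^sup>2"
  have "case_prod ?D \<in> borel_measurable (borel \<Otimes>\<^sub>M borel)"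
    unfolding borel_prod[symmetric] by measurable
  moreover have "(\<integral>\<^sup>+w. ennreal (?D x w) \<partial>(\<mu> k x \<Otimes>\<^sub>M \<nu> k x)) = 0" for x
    by (subst nn_integral_pair_snd[OF kernel_props(1,2)[OF k] borel_measurable_kernel(2)[OF k], of "\<lambda>v. ennreal ((norm (v - F *v x))\<^sup>2)"])
      (auto simp: \<nu> nn_integral_return)
  ultimately show "integrable (law (length \<pi> - 1)) (\<lambda>h. ?D (X h k) (h k))"
    "(\<integral>h. ?D (X h k) (h k) \<partial>law (length \<pi> - 1)) = 0"
    using zero_defect_integral[OF k, of ?D] by auto
qed

text \<open>The local errors are of third order in the step: two orders are estimated by the mesh,
  and the remaining steps sum to the horizon.\<close>

lemma accumulated_error:
  fixes c s :: real
  assumes D: "\<And>k. Suc k < length \<pi> \<Longrightarrow> integrable (law (length \<pi> - 1)) (D k)"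
    "\<And>k. Suc k < length \<pi> \<Longrightarrow> (\<integral>h. D k h \<partial>law (length \<pi> - 1)) = 0"
    and s: "0 \<le> s"
  defines "E \<equiv> \<lambda>h. \<Sum>k<length \<pi> - 1. step k * (c * D k h + s * (step k)\<^sup>2 * sq_size (X h k) (h k))"
  shows "integrable (law (length \<pi> - 1)) E"
    and "(\<integral>h. E h \<partial>law (length \<pi> - 1)) \<le> s * moment_const * (t_final G - t_init G) * (mesh \<pi>)\<^sup>2"
proof -
  let ?N = "length \<pi> - 1"
  have k: "Suc k < length \<pi>" if "k < ?N" for k using that by simp
  have int: "integrable (law ?N) (\<lambda>h. step k * (c * D k h + s * (step k)\<^sup>2 * sq_size (X h k) (h k)))" if "k < ?N" for k
    using D(1)[OF k[OF that]] sq_size_integral(1)[OF k[OF that]] by auto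
  then show "integrable (law ?N) E"
    unfolding E_def by (intro Bochner_Integration.integrable_sum) auto
  have "(\<integral>h. E h \<partial>law ?N) = (\<Sum>k<?N. (\<integral>h. step k * (c * D k h + s * (step k)\<^sup>2 * sq_size (X h k) (h k)) \<partial>law ?N))"
    unfolding E_def by (intro Bochner_Integration.integral_sum int) auto
  also have "\<dots> = (\<Sum>k<?N. step k * (s * (step k)\<^sup>2 * (\<integral>h. sq_size (X h k) (h k) \<partial>law ?N)))"
  proof (rule sum.cong[OF refl])
    fix k assume "k \<in> {..<?N}"
    then have k: "Suc k < length \<pi>" by simp
    show "(\<integral>h. step k * (c * D k h + s * (step k)\<^sup>2 * sq_size (X h k) (h k)) \<partial>law ?N)
      = step k * (s * (step k)\<^sup>2 * (\<integral>h. sq_size (X h k) (h k) \<partial>law ?N))"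
      using D(1,2)[OF k] sq_size_integral(1)[OF k]
      by (subst integral_mult_right_zero, subst Bochner_Integration.integral_add) auto
  qed
  also have "\<dots> \<le> (\<Sum>k<?N. step k * (s * (mesh \<pi>)\<^sup>2 * moment_const))"
  proof (rule sum_mono)
    fix k assume "k \<in> {..<?N}"
    then have k: "Suc k < length \<pi>" by simp
    show "step k * (s * (step k)\<^sup>2 * (\<integral>h. sq_size (X h k) (h k) \<partial>law ?N)) \<le> step k * (s * (mesh \<pi>)\<^sup>2 * moment_const)"
      using step_bounds[OF k] step_le_mesh[OF k] s
      by (intro mult_left_mono mult_mono power_mono sq_size_integral(2)[OF k] order_refl) auto
  qed
  also have "\<dots> = (\<Sum>k<?N. step k) * (s * (mesh \<pi>)\<^sup>2 * moment_const)"
    by (rule sum_distrib_right[symmetric])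
  also have "(\<Sum>k<?N. step k) = t_final G - t_init G"
    using partition_of_nth(2,3)[OF part] by (simp only: sum_lessThan_telescope)
  finally show "(\<integral>h. E h \<partial>law ?N) \<le> s * moment_const * (t_final G - t_init G) * (mesh \<pi>)\<^sup>2"
    by (simp add: mult_ac)
qed

lemma expected_cost_le:
  fixes c s V :: real
  assumes D: "\<And>k. Suc k < length \<pi> \<Longrightarrow> integrable (law (length \<pi> - 1)) (D k)"
    "\<And>k. Suc k < length \<pi> \<Longrightarrow> (\<integral>h. D k h \<partial>law (length \<pi> - 1)) = 0"
    and s: "0 \<le> s"
    and le: "\<And>h. path_cost G \<pi> h
      \<le> V + (\<Sum>k<length \<pi> - 1. step k * (c * D k h + s * (step k)\<^sup>2 * sq_size (X h k) (h k)))"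
  shows "expected_cost G \<pi> \<mu> \<nu> \<le> V + s * moment_const * (t_final G - t_init G) * (mesh \<pi>)\<^sup>2"
proof -
  interpret L: prob_space "law (length \<pi> - 1)"
    by (rule law_props(1)) simp
  note E = accumulated_error[where D = D and c = c, OF D s]
  have "expected_cost G \<pi> \<mu> \<nu>
      \<le> (\<integral>h. V + (\<Sum>k<length \<pi> - 1. step k * (c * D k h + s * (step k)\<^sup>2 * sq_size (X h k) (h k))) \<partial>law (length \<pi> - 1))"
    unfolding expected_cost_eq
    by (intro integral_mono integrable_path_cost Bochner_Integration.integrable_add L.integrable_const E(1) le)
  also have "\<dots> = V + (\<integral>h. (\<Sum>k<length \<pi> - 1. step k * (c * D k h + s * (step k)\<^sup>2 * sq_size (X h k) (h k))) \<partial>law (length \<pi> - 1))"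
    using L.prob_space by (subst Bochner_Integration.integral_add[OF L.integrable_const E(1)]) simp_all
  finally show ?thesis
    using E(2) by linarith
qed

lemma expected_cost_ge:
  fixes c s V :: real
  assumes D: "\<And>k. Suc k < length \<pi> \<Longrightarrow> integrable (law (length \<pi> - 1)) (D k)"
    "\<And>k. Suc k < length \<pi> \<Longrightarrow> (\<integral>h. D k h \<partial>law (length \<pi> - 1)) = 0"
    and s: "0 \<le> s"
    and ge: "\<And>h. V - (\<Sum>k<length \<pi> - 1. step k * (c * D k h + s * (step k)\<^sup>2 * sq_size (X h k) (h k)))
      \<le> path_cost G \<pi> h"
  shows "V - s * moment_const * (t_final G - t_init G) * (mesh \<pi>)\<^sup>2 \<le> expected_cost G \<pi> \<mu> \<nu>"
proof -
  interpret L: prob_space "law (length \<pi> - 1)"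
    by (rule law_props(1)) simp
  note E = accumulated_error[where D = D and c = c, OF D s]
  have "V - (\<integral>h. (\<Sum>k<length \<pi> - 1. step k * (c * D k h + s * (step k)\<^sup>2 * sq_size (X h k) (h k))) \<partial>law (length \<pi> - 1))
      = (\<integral>h. V - (\<Sum>k<length \<pi> - 1. step k * (c * D k h + s * (step k)\<^sup>2 * sq_size (X h k) (h k))) \<partial>law (length \<pi> - 1))"
    using L.prob_space by (subst Bochner_Integration.integral_diff[OF L.integrable_const E(1)]) simp_all
  also have "\<dots> \<le> expected_cost G \<pi> \<mu> \<nu>"
    unfolding expected_cost_eq
    by (intro integral_mono integrable_path_cost Bochner_Integration.integrable_diff L.integrable_const E(1) ge)
  finally show ?thesis
    using E(2) by linarith
qed

end

section \<open>Guaranteed levels of the two synthesized strategies\<close>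

context riccati_game
begin

definition riccati_value where
  "riccati_value = x_init G \<bullet> (P (t_init G) *v x_init G)"

lemma expected_cost_alpha_d_le:
  assumes lam: "\<And>t. t \<in> {t_init G..t_final G} \<Longrightarrow> lam2 G \<pi> P t = 0"
    and \<nu>: "\<nu> \<in> mixed_strategies (gam2 G) \<pi>"
  shows "expected_cost G \<pi> (alpha_d G \<pi> P) \<nu> \<le> riccati_value
    + sampling_error G W\<^sub>1 (mat_R1 G) * strategy_pair.moment_const G * (t_final G - t_init G) * (mesh \<pi>)\<^sup>2"
proof -
  interpret S: strategy_pair G \<pi> "alpha_d G \<pi> P" \<nu>
    by unfold_locales (use time part \<nu> alpha_d_mixed[OF data ric cap part] in auto)
  have \<alpha>: "alpha_d G \<pi> P k x = return borel ((- K\<^sub>1 k) *v x)" for k x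
    by (simp add: alpha_d_eq matrix_vector_mult_minus_left)
  show ?thesis
  proof (rule S.expected_cost_le[where c = "2 * norm (mat_R1 G)"
        and D = "\<lambda>k h. (norm (fst (h k) - (- K\<^sub>1 k) *v grid_state G \<pi> h k))\<^sup>2"])
    show "path_cost G \<pi> h \<le> riccati_value + (\<Sum>k<length \<pi> - 1. step k *
        (2 * norm (mat_R1 G) * (norm (fst (h k) - (- K\<^sub>1 k) *v grid_state G \<pi> h k))\<^sup>2
        + sampling_error G W\<^sub>1 (mat_R1 G) * (step k)\<^sup>2 * sq_size (grid_state G \<pi> h k) (h k)))" for h
      using path_cost_bounds(1)[OF lam, of h] by (simp add: riccati_value_def matrix_vector_mult_minus_left)
  qed (use S.zero_defect_minimizer[OF _ \<alpha>] in auto)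
qed

lemma expected_cost_beta_d_ge:
  assumes neg: "\<And>t. t \<in> {t_init G..t_final G} \<Longrightarrow> lambda_max (Q2eq G \<pi> P t) < 0"
    and \<mu>: "\<mu> \<in> mixed_strategies (gam1 G) \<pi>"
  shows "riccati_value
    - sampling_error G W\<^sub>2 (mat_R2 G) * strategy_pair.moment_const G * (t_final G - t_init G) * (mesh \<pi>)\<^sup>2
    \<le> expected_cost G \<pi> \<mu> (beta_d G \<pi> P v2)"
proof -
  interpret S: strategy_pair G \<pi> \<mu> "beta_d G \<pi> P v2"
    by unfold_locales (use time part \<mu> beta_d_mixed[OF data ric cap part top] in auto)
  have lam: "lam2 G \<pi> P t = 0" if "t \<in> {t_init G..t_final G}" for t
    using neg[OF that] by (simp add: lam2_def)
  \<comment> \<open>The indicator in the covariance is 0, so \<open>gaussian_zero\<close>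
    applies.\<close>
  have \<beta>: "beta_d G \<pi> P v2 k x = return borel (K\<^sub>2 k *v x)" if "Suc k < length \<pi>" for k x
    using neg[of "\<pi> ! k"] partition_nth_bounds[OF part, of k] that by (simp add: beta_d_def gaussian_zero)
  have norm: "norm (snd w - K\<^sub>2 k *v x) = norm (- snd w + K\<^sub>2 k *v x)"
    for w :: "(real^'p) \<times> (real^'q)" and k x
    by (simp add: norm_minus_commute)
  show ?thesis
  proof (rule S.expected_cost_ge[where c = "2 * norm (mat_R2 G)"
        and D = "\<lambda>k h. (norm (snd (h k) - K\<^sub>2 k *v grid_state G \<pi> h k))\<^sup>2"])
    show "riccati_value - (\<Sum>k<length \<pi> - 1. step k *
        (2 * norm (mat_R2 G) * (norm (snd (h k) - K\<^sub>2 k *v grid_state G \<pi> h k))\<^sup>2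
        + sampling_error G W\<^sub>2 (mat_R2 G) * (step k)\<^sup>2 * sq_size (grid_state G \<pi> h k) (h k))) \<le> path_cost G \<pi> h" for h
      using path_cost_bounds(2)[OF lam, of h] unfolding norm riccati_value_def .
  qed (use S.zero_defect_maximizer[OF _ \<beta>] in auto)
qed

end

text \<open>Minimum and maximum are rendered as \<open>INF\<close> and \<open>SUP\<close>, which
  agree with them whenever they are attained; the boundedness claims exclude arbitrary values of
  \<open>INF\<close> and \<open>SUP\<close> on unbounded sets of reals. \<open>C\<close> and the
  mesh threshold are chosen before the partition, which makes the estimate uniform.\<close>

theorem theorem5:
  fixes G :: "('n::finite, 'p::finite, 'q::finite) lq_game"
  assumes "lq_game_data G"
  shows "(\<forall>\<pi> P v2.
            partition_of (t_init G) (t_final G) \<pi> \<and> riccati_solution G \<pi> P \<and>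
            capacity_conditions G \<pi> P \<and> top_eigenvector G \<pi> P v2 \<longrightarrow>
              alpha_d G \<pi> P \<in> mixed_strategies (gam1 G) \<pi> \<and>
              beta_d G \<pi> P v2 \<in> mixed_strategies (gam2 G) \<pi>) \<and>
         (\<exists>C. \<exists>\<epsilon>>0. \<forall>\<pi> P v2.
            partition_of (t_init G) (t_final G) \<pi> \<and> mesh \<pi> < \<epsilon> \<and> riccati_solution G \<pi> P \<and>
            capacity_conditions G \<pi> P \<and> top_eigenvector G \<pi> P v2 \<longrightarrow>
              bdd_below ((\<lambda>\<mu>. expected_cost G \<pi> \<mu> (beta_d G \<pi> P v2)) ` mixed_strategies (gam1 G) \<pi>) \<and>
              expected_cost G \<pi> (alpha_d G \<pi> P) (beta_d G \<pi> P v2)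
                - (INF \<mu>\<in>mixed_strategies (gam1 G) \<pi>. expected_cost G \<pi> \<mu> (beta_d G \<pi> P v2))
                \<le> C * mesh \<pi> powr (1/2) \<and>
              bdd_above ((\<lambda>\<nu>. expected_cost G \<pi> (alpha_d G \<pi> P) \<nu>) ` mixed_strategies (gam2 G) \<pi>) \<and>
              (SUP \<nu>\<in>mixed_strategies (gam2 G) \<pi>. expected_cost G \<pi> (alpha_d G \<pi> P) \<nu>)
                - expected_cost G \<pi> (alpha_d G \<pi> P) (beta_d G \<pi> P v2)
                \<le> C * mesh \<pi> powr (1/2))"
proof (intro conjI allI impI)
  fix \<pi> P v2
  assume "partition_of (t_init G) (t_final G) \<pi> \<and> riccati_solution G \<pi> P \<and>
    capacity_conditions G \<pi> P \<and> top_eigenvector G \<pi> P v2"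
  then show "alpha_d G \<pi> P \<in> mixed_strategies (gam1 G) \<pi>" "beta_d G \<pi> P v2 \<in> mixed_strategies (gam2 G) \<pi>"
    using assms by (auto intro: alpha_d_mixed beta_d_mixed)
next
  obtain \<epsilon> where \<epsilon>: "0 < \<epsilon>" "\<epsilon> \<le> 1"
    "\<And>\<pi> P v2 t. riccati_game G \<pi> P v2 \<Longrightarrow> mesh \<pi> < \<epsilon> \<Longrightarrow> t \<in> {t_init G..t_final G} \<Longrightarrow>
      lambda_max (Q2eq G \<pi> P t) < 0"
    using small_mesh_Q2eq_negative[OF assms] by blast
  define C1 where "C1 = sampling_error G (matrix_inv (mat_R1 G) ** transpose (mat_B1 G)) (mat_R1 G)
    * strategy_pair.moment_const G * (t_final G - t_init G)"
  define C2 where "C2 = sampling_error G (matrix_inv (mat_R2 G) ** transpose (mat_B2 G)) (mat_R2 G)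
    * strategy_pair.moment_const G * (t_final G - t_init G)"
  show "\<exists>C. \<exists>\<epsilon>>0. \<forall>\<pi> P v2.
            partition_of (t_init G) (t_final G) \<pi> \<and> mesh \<pi> < \<epsilon> \<and> riccati_solution G \<pi> P \<and>
            capacity_conditions G \<pi> P \<and> top_eigenvector G \<pi> P v2 \<longrightarrow>
              bdd_below ((\<lambda>\<mu>. expected_cost G \<pi> \<mu> (beta_d G \<pi> P v2)) ` mixed_strategies (gam1 G) \<pi>) \<and>
              expected_cost G \<pi> (alpha_d G \<pi> P) (beta_d G \<pi> P v2)
                - (INF \<mu>\<in>mixed_strategies (gam1 G) \<pi>. expected_cost G \<pi> \<mu> (beta_d G \<pi> P v2))
                \<le> C * mesh \<pi> powr (1/2) \<and>
              bdd_above ((\<lambda>\<nu>. expected_cost G \<pi> (alpha_d G \<pi> P) \<nu>) ` mixed_strategies (gam2 G) \<pi>) \<and>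
              (SUP \<nu>\<in>mixed_strategies (gam2 G) \<pi>. expected_cost G \<pi> (alpha_d G \<pi> P) \<nu>)
                - expected_cost G \<pi> (alpha_d G \<pi> P) (beta_d G \<pi> P v2)
                \<le> C * mesh \<pi> powr (1/2)"
  \<comment> \<open>Each gap compares an upper bound secured by one player with a lower bound
    secured by the other, so the two errors add. The absolute value supplies the sign that the
    monotonicity of products asks for.\<close>
  proof (rule exI[of _ "\<bar>C1 + C2\<bar>"], rule exI[of _ \<epsilon>], intro conjI[OF \<epsilon>(1)] allI impI)
    fix \<pi> P v2
    assume h: "partition_of (t_init G) (t_final G) \<pi> \<and> mesh \<pi> < \<epsilon> \<and> riccati_solution G \<pi> P \<and>
      capacity_conditions G \<pi> P \<and> top_eigenvector G \<pi> P v2"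
    then interpret riccati_game G \<pi> P v2
      using assms by unfold_locales auto
    have neg: "lambda_max (Q2eq G \<pi> P t) < 0" if "t \<in> {t_init G..t_final G}" for t
      using \<epsilon>(3)[OF riccati_game_axioms] h that by blast
    then have lam: "lam2 G \<pi> P t = 0" if "t \<in> {t_init G..t_final G}" for t
      using that by (simp add: lam2_def)
    let ?J = "expected_cost G \<pi>" and ?\<alpha> = "alpha_d G \<pi> P" and ?\<beta> = "beta_d G \<pi> P v2"
    let ?c = "\<bar>C1 + C2\<bar> * mesh \<pi> powr (1/2)"
    have \<alpha>: "?\<alpha> \<in> mixed_strategies (gam1 G) \<pi>" and \<beta>: "?\<beta> \<in> mixed_strategies (gam2 G) \<pi>"
      using h assms by (auto intro: alpha_d_mixed beta_d_mixed)
    have up: "?J ?\<alpha> \<nu> \<le> riccati_value + C1 * (mesh \<pi>)\<^sup>2" if "\<nu> \<in> mixed_strategies (gam2 G) \<pi>" for \<nu>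
      using expected_cost_alpha_d_le[OF lam that] by (simp add: C1_def)
    have low: "riccati_value - C2 * (mesh \<pi>)\<^sup>2 \<le> ?J \<mu> ?\<beta>" if "\<mu> \<in> mixed_strategies (gam1 G) \<pi>" for \<mu>
      using expected_cost_beta_d_ge[OF neg that] by (simp add: C2_def)
    have "(mesh \<pi>)\<^sup>2 = mesh \<pi> powr 2"
      using mesh_pos by simp
    also have "\<dots> \<le> mesh \<pi> powr (1/2)"
      using mesh_pos h \<epsilon>(2) by (intro powr_mono') auto
    finally have "(C1 + C2) * (mesh \<pi>)\<^sup>2 \<le> ?c"
      by (intro mult_mono) auto
    then have err: "C1 * (mesh \<pi>)\<^sup>2 + C2 * (mesh \<pi>)\<^sup>2 \<le> ?c"
      by (simp add: distrib_right)
    \<comment> \<open>Both costs are compared with \<open>riccati_value\<close>, which cancels; the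
      same happens in the bound for the maximizer.\<close>
    have low': "?J ?\<alpha> ?\<beta> - ?c \<le> ?J \<mu> ?\<beta>" if "\<mu> \<in> mixed_strategies (gam1 G) \<pi>" for \<mu>
      using up[OF \<beta>] low[OF that] err by linarith
    have up': "?J ?\<alpha> \<nu> \<le> ?J ?\<alpha> ?\<beta> + ?c" if "\<nu> \<in> mixed_strategies (gam2 G) \<pi>" for \<nu>
      using up[OF that] low[OF \<alpha>] err by linarith
    have "?J ?\<alpha> ?\<beta> - ?c \<le> (INF \<mu>\<in>mixed_strategies (gam1 G) \<pi>. ?J \<mu> ?\<beta>)"
      using \<alpha> low' by (intro cINF_greatest) auto
    moreover have "(SUP \<nu>\<in>mixed_strategies (gam2 G) \<pi>. ?J ?\<alpha> \<nu>) \<le> ?J ?\<alpha> ?\<beta> + ?c"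
      using \<beta> up' by (intro cSUP_least) auto
    moreover have "bdd_below ((\<lambda>\<mu>. ?J \<mu> ?\<beta>) ` mixed_strategies (gam1 G) \<pi>)"
      using low' by (rule bdd_belowI2)
    moreover have "bdd_above ((\<lambda>\<nu>. ?J ?\<alpha> \<nu>) ` mixed_strategies (gam2 G) \<pi>)"
      using up' by (rule bdd_aboveI2)
    ultimately show "bdd_below ((\<lambda>\<mu>. ?J \<mu> ?\<beta>) ` mixed_strategies (gam1 G) \<pi>) \<and>
        ?J ?\<alpha> ?\<beta> - (INF \<mu>\<in>mixed_strategies (gam1 G) \<pi>. ?J \<mu> ?\<beta>) \<le> ?c \<and>
        bdd_above ((\<lambda>\<nu>. ?J ?\<alpha> \<nu>) ` mixed_strategies (gam2 G) \<pi>) \<and>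
        (SUP \<nu>\<in>mixed_strategies (gam2 G) \<pi>. ?J ?\<alpha> \<nu>) - ?J ?\<alpha> ?\<beta> \<le> ?c"
      by linarith
  qed
qed

end
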